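(* Let $X$ be a finite connected graph such that $\chi(X)\ne0$, and fix a voltage assignment $\alpha\colon\mathbf{E}_X\to\mathbb{Z}$ such that $X(\mathbb{Z},\alpha)$ is connected. For $n\in\mathbb{N}$ let $X_n := X(\mathbb{Z}/n\mathbb{Z},\pi_n\circ\alpha)$, where $\pi_n\colon\mathbb{Z}\to\mathbb{Z}/n\mathbb{Z}$ is the quotient map. Let $\mathcal{I}_\alpha$ be the Ihara polynomial of $\alpha$, $b := -\mathrm{ord}_{t=0}(\mathcal{I}_\alpha)$, $I_\alpha(t) := t^b\mathcal{I}_\alpha(t)\in\mathbb{Z}[t]$, $e := \mathrm{ord}_{t=1}(\mathcal{I}_\alpha)$, and let $J_\alpha\in\mathbb{Z}[t]$ be defined by $I_\alpha(t)=(t-1)^eJ_\alpha(t)$. Fix a rational prime $p$. If $J_\alpha$ has no root on the unit circle $\{x\in\mathbb{C}_p:|x|_p=1\}$ of $\mathbb{C}_p$, then $$|\kappa(X_n)|_p=|n|_p^{e-1}\,\frac{|\kappa(X)|_p}{|\Delta_1(J_\alpha)|_p}\,M_p(I_\alpha)^n$$ for every $n\in\mathbb{N}$.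
   Context: $\mathbb{N}=\{1,2,\dots\}$. $|\cdot|_p$ is the absolute value on $\mathbb{C}_p$ (completion of an algebraic closure of $\mathbb{Q}_p$) with $|p|_p=1/p$. Graphs are in the sense of Serre: a graph $X$ consists of a set $V_X$ of vertices, a set $\mathbf{E}_X$ of directed edges, origin and terminus maps $o,t\colon\mathbf{E}_X\to V_X$, and an inversion $e\mapsto\bar e$ on $\mathbf{E}_X$ with $o(\bar e)=t(e)$, $t(\bar e)=o(e)$ and $\bar{\bar e}=e\ne\bar e$. Loops and multiple edges are allowed. $X$ is finite if $V_X$ and $\mathbf{E}_X$ are finite, and connected if any two vertices are joined by a path of directed edges. $\chi(X)=|V_X|-|\mathbf{E}_X|/2$, and $\kappa(X)$ is the number of spanning trees of a finite graph $X$. A voltage assignment with values in a group $G$ is a function $\alpha\colon\mathbf{E}_X\to G$ with $\alpha(\bar e)=\alpha(e)^{-1}$ for all $e$. The graph $X(G,\alpha)$ has vertex set $V_X\times G$, edge set $\mathbf{E}_X\times G$, and $o(e,\sigma)=(o(e),\sigma)$, $t(e,\sigma)=(t(e),\sigma\cdot\alpha(e))$, $\overline{(e,\sigma)}=(\bar e,\sigma\cdot\alpha(e))$. Ihara polynomial of $\alpha\colon\mathbf{E}_X\to\mathbb{Z}$: order $V_X=\{v_1,\dots,v_g\}$, let $D_X$ be the diagonal matrix with entries $\#\{e\in\mathbf{E}_X: o(e)=v_i\}$, and let $A_\alpha(t)$ be the $g\times g$ matrix with $(i,j)$ entry $\sum_{e:\,o(e)=v_i,\,t(e)=v_j}t^{\alpha(e)}$;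 then $\mathcal{I}_\alpha(t)=\det(D_X-A_\alpha(t))\in\mathbb{Z}[t^{\pm1}]$. $\mathrm{ord}_{t=a}$ denotes the order of vanishing at $t=a$. For $f(t)=a_d\prod_{i=1}^d(t-\alpha_i)\in\mathbb{Z}[t]$ with $a_d\ne0$ and $\alpha_i\in\mathbb{C}_p$: $\Delta_n(f)=a_d^n\prod_{i=1}^d(\alpha_i^n-1)\in\mathbb{Z}$ is the Pierce-Lehmer sequence, and $M_p(f)=|a_d|_p\prod_{i=1}^d\max\{1,|\alpha_i|_p\}$ is the $p$-adic Mahler measure. *)

theory Defs
  imports
    "HOL-Analysis.Abstract_Metric_Spaces"
    "HOL-Algebra.Elementary_Groups"
    "HOL-Computational_Algebra.Formal_Laurent_Series"
    "HOL-Computational_Algebra.Polynomial_FPS"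
    "HOL-Computational_Algebra.Primes"
    "Jordan_Normal_Form.Determinant"
    "Graph_Theory.Graph_Theory"
begin

section \<open>Graphs in the sense of Serre\<close>

text \<open>
  A graph in the sense of Serre is a pair \<open>X\<close>, \<open>bar\<close> with \<^term>\<open>bidirected_digraph X bar\<close>;
  the arcs are the directed edges, and \<open>tail\<close>, \<open>head\<close>, \<open>bar\<close> are origin, terminus and
  inversion.  That locale also normalises \<open>bar\<close> to be the identity outside of the arcs, which is no
  restriction.  As \<open>bar\<close> exchanges origin and terminus, connectedness is
  \<^const>\<open>strongly_connected\<close> (which includes that there is a vertex).
\<close>

definition euler_char :: "('v, 'e) pre_digraph \<Rightarrow> real" where
  "euler_char X = real (card (verts X)) - real (card (arcs X)) / 2"

text \<open>
  The library predicate \<open>cycle\<close> admits \<open>[e, bar e]\<close>, which is not a circuit of a graph in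
  the sense of Serre; apart from these it gives the circuits (of length 1, 2, 3, ...).  For the same
  reason the library predicates \<open>forest\<close> and \<open>spanning_tree\<close> cannot be used.
\<close>

definition circuit :: "('v, 'e) pre_digraph \<Rightarrow> ('e \<Rightarrow> 'e) \<Rightarrow> 'e list \<Rightarrow> bool" where
  "circuit X bar c \<longleftrightarrow> pre_digraph.cycle X c \<and> (\<forall>e \<in> set c. bar e \<notin> set c)"

definition is_tree :: "('v, 'e) pre_digraph \<Rightarrow> ('e \<Rightarrow> 'e) \<Rightarrow> bool" where
  "is_tree X bar \<longleftrightarrow> strongly_connected X \<and> (\<nexists>c. circuit X bar c)"

text \<open>A spanning tree is identified with its set of directed edges, which is closed under inversion.\<close>

definition spanning_trees :: "('v, 'e) pre_digraph \<Rightarrow> ('e \<Rightarrow> 'e) \<Rightarrow> 'e set set" where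
  "spanning_trees X bar =
     {T. T \<subseteq> arcs X \<and> (\<forall>e \<in> T. bar e \<in> T) \<and> is_tree (X\<lparr>arcs := T\<rparr>) bar}"

definition num_spanning_trees :: "('v, 'e) pre_digraph \<Rightarrow> ('e \<Rightarrow> 'e) \<Rightarrow> nat" where
  "num_spanning_trees X bar = card (spanning_trees X bar)"


section \<open>Voltage assignments and derived graphs\<close>

definition voltage_assignment ::
    "('v, 'e) pre_digraph \<Rightarrow> ('e \<Rightarrow> 'e) \<Rightarrow> 'g monoid \<Rightarrow> ('e \<Rightarrow> 'g) \<Rightarrow> bool" where
  "voltage_assignment X bar G \<alpha> \<longleftrightarrow>
     (\<forall>e \<in> arcs X. \<alpha> e \<in> carrier G \<and> \<alpha> (bar e) = inv\<^bsub>G\<^esub> (\<alpha> e))"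

definition derived_graph ::
    "('v, 'e) pre_digraph \<Rightarrow> 'g monoid \<Rightarrow> ('e \<Rightarrow> 'g) \<Rightarrow> ('v \<times> 'g, 'e \<times> 'g) pre_digraph" where
  "derived_graph X G \<alpha> =
     \<lparr>verts = verts X \<times> carrier G,
      arcs = arcs X \<times> carrier G,
      tail = (\<lambda>(e, \<sigma>). (tail X e, \<sigma>)),
      head = (\<lambda>(e, \<sigma>). (head X e, \<sigma> \<otimes>\<^bsub>G\<^esub> \<alpha> e))\<rparr>"

definition derived_bar ::
    "('v, 'e) pre_digraph \<Rightarrow> ('e \<Rightarrow> 'e) \<Rightarrow> 'g monoid \<Rightarrow> ('e \<Rightarrow> 'g) \<Rightarrow> 'e \<times> 'g \<Rightarrow> 'e \<times> 'g" where
  "derived_bar X bar G \<alpha> =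
     (\<lambda>(e, \<sigma>). if e \<in> arcs X \<and> \<sigma> \<in> carrier G then (bar e, \<sigma> \<otimes>\<^bsub>G\<^esub> \<alpha> e) else (e, \<sigma>))"

lemma bidirected_digraph_derived_graph:
  assumes "bidirected_digraph X bar" "group G" "voltage_assignment X bar G \<alpha>"
  shows "bidirected_digraph (derived_graph X G \<alpha>) (derived_bar X bar G \<alpha>)"
proof -
  interpret X: bidirected_digraph X bar by fact
  interpret G: group G by fact
  have \<alpha>: "\<alpha> e \<in> carrier G" "\<alpha> (bar e) = inv\<^bsub>G\<^esub> (\<alpha> e)" if "e \<in> arcs X" for e
    using assms(3) that by (auto simp: voltage_assignment_def)
  show ?thesis
    by unfold_locales
      (auto simp: derived_graph_def derived_bar_def \<alpha> X.arev_neq G.m_assoc split: if_splits)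
qed


section \<open>The Ihara polynomial\<close>

text \<open>
  Laurent polynomials with integer coefficients are regarded as elements of the ring
  \<^typ>\<open>int fls\<close> of formal Laurent series in \<open>t\<close>; there \<^term>\<open>fls_X_intpow k\<close> is the
  monomial \<open>t\<^sup>k\<close>.
\<close>

abbreviation fls_of_poly :: "int poly \<Rightarrow> int fls" where
  "fls_of_poly P \<equiv> fps_to_fls (fps_of_poly P)"

text \<open>The vertices are ordered by means of a list \<open>vs\<close>.\<close>

definition valency_mat :: "('v, 'e) pre_digraph \<Rightarrow> 'v list \<Rightarrow> int fls mat" where
  "valency_mat X vs = mat (length vs) (length vs)
     (\<lambda>(i, j). if i = j then of_nat (card {e \<in> arcs X. tail X e = vs ! i}) else 0)"

definition adjacency_mat :: "('v, 'e) pre_digraph \<Rightarrow> ('e \<Rightarrow> int) \<Rightarrow> 'v list \<Rightarrow> int fls mat" where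
  "adjacency_mat X \<alpha> vs = mat (length vs) (length vs)
     (\<lambda>(i, j). \<Sum>e \<in> {e \<in> arcs X. tail X e = vs ! i \<and> head X e = vs ! j}. fls_X_intpow (\<alpha> e))"

definition ihara :: "('v, 'e) pre_digraph \<Rightarrow> ('e \<Rightarrow> int) \<Rightarrow> 'v list \<Rightarrow> int fls" where
  "ihara X \<alpha> vs = Determinant.det (valency_mat X vs - adjacency_mat X \<alpha> vs)"

text \<open>
  The order of vanishing at \<open>t = a\<close> of a nonzero Laurent polynomial \<open>L\<close>.  For \<open>a \<noteq> 0\<close>,
  multiplying by a power of \<open>t\<close> does not change it, so it is the order of the polynomial
  \<open>P = t\<^sup>-\<^sup>k L\<close> with \<open>k\<close> the order of \<open>L\<close> at \<open>0\<close>.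
\<close>

definition laurent_ord :: "int \<Rightarrow> int fls \<Rightarrow> int" where
  "laurent_ord a L =
     (if a = 0 then fls_subdegree L
      else int (Polynomial.order a
             (THE P. fls_of_poly P = fls_X_intpow (- fls_subdegree L) * L)))"


section \<open>The field of p-adic complex numbers\<close>

definition av_closure :: "('a :: field_char_0 \<Rightarrow> real) \<Rightarrow> 'a set \<Rightarrow> 'a set" where
  "av_closure av S = Metric_space.mtopology UNIV (\<lambda>x y. av (x - y)) closure_of S"

definition algebraic_over :: "'a :: field_char_0 set \<Rightarrow> 'a set" where
  "algebraic_over K = {x. \<exists>f. f \<noteq> 0 \<and> (\<forall>i. poly.coeff f i \<in> K) \<and> poly f x = 0}"

text \<open>
  \<open>padic_complex p av\<close> says that the field \<^typ>\<open>'a\<close> with the absolute value \<open>av\<close> is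
  (up to isometric isomorphism) the completion of an algebraic closure of the field of p-adic
  numbers, normalised by \<open>av p = 1 / p\<close>.

  A multiplicative ultrametric absolute value on the rationals with \<open>av p = 1 / p\<close> is the p-adic
  one, and the closure of the rationals in the complete field \<^typ>\<open>'a\<close> is their completion;
  so \<^term>\<open>av_closure av \<rat>\<close> is the field of p-adic numbers.  The elements algebraic over
  it form an algebraic closure by \<open>alg_closed\<close>, and \<^typ>\<open>'a\<close> is the completion of the latter
  by \<open>dense\<close> and \<open>complete\<close>.
\<close>

locale padic_complex =
  fixes p :: nat and av :: "'a :: field_char_0 \<Rightarrow> real"
  assumes prime_p: "prime p"
    and av_nonneg: "av x \<ge> 0"
    and av_eq_0_iff: "av x = 0 \<longleftrightarrow> x = 0"
    and av_mult: "av (x * y) = av x * av y"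
    and av_add: "av (x + y) \<le> max (av x) (av y)"
    and av_p: "av (of_nat p) = 1 / real p"
    and complete: "Metric_space.mcomplete UNIV (\<lambda>x y. av (x - y))"
    and alg_closed: "\<lbrakk>\<forall>i. poly.coeff f i \<in> algebraic_over (av_closure av \<rat>); Polynomial.degree f > 0\<rbrakk>
                      \<Longrightarrow> \<exists>x \<in> algebraic_over (av_closure av \<rat>). poly f x = 0"
    and dense: "av_closure av (algebraic_over (av_closure av \<rat>)) = UNIV"


section \<open>Pierce--Lehmer sequence and p-adic Mahler measure\<close>

text \<open>
  \<^const>\<open>proots\<close> is the multiset of roots in the field \<^typ>\<open>'a\<close>, over which \<open>f\<close> is to split; for
  \<open>pierce_lehmer\<close> the integer is given by its image in \<^typ>\<open>'a\<close>.
\<close>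

definition pierce_lehmer :: "nat \<Rightarrow> int poly \<Rightarrow> 'a :: field_char_0" where
  "pierce_lehmer n f =
     of_int (lead_coeff f) ^ n * (\<Prod>x \<in># proots (map_poly of_int f). x ^ n - 1)"

definition mahler :: "('a :: field_char_0 \<Rightarrow> real) \<Rightarrow> int poly \<Rightarrow> real" where
  "mahler av f =
     av (of_int (lead_coeff f)) * (\<Prod>x \<in># proots (map_poly of_int f). max 1 (av x))"

end

theory Submission
  imports Defs "Jordan_Normal_Form.Char_Poly"
begin

text \<open>
  Let \<open>L(z)\<close> be the Laplacian of \<open>X\<close> twisted by \<open>e \<mapsto> z\<^sup>\<alpha>\<^sup>(\<^sup>e\<^sup>)\<close>, so that \<open>det L(z)\<close> is the value of
  the Ihara polynomial at \<open>z\<close>.  The Laplacian of \<open>X\<^sub>n\<close> is block-circulant, and the Fourier transform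
  over \<open>\<int>/n\<close> (with the \<open>n\<close>-th roots of unity of \<open>\<complex>\<^sub>p\<close> itself) splits its characteristic polynomial
  into those of the \<open>L(z)\<close>, \<open>z\<^sup>n = 1\<close>.  By the matrix-tree theorem the linear coefficients give
  \<open>n \<kappa>(X\<^sub>n) = \<kappa>(X) \<Prod>\<^sub>z\<^sub>\<noteq>\<^sub>1 det L(z)\<close>.  Up to units \<open>det L(z)\<close> is \<open>(z - 1)\<^sup>e J(z)\<close>; the product of the
  \<open>z - 1\<close> is \<open>n\<close> up to sign, and the product of the \<open>J(z)\<close> over all \<open>z\<close> is \<open>\<Delta>\<^sub>n(J)\<close> up to sign.
  If no root of \<open>J\<close> lies on the unit circle, the ultrametric inequality evaluates
  \<open>|a\<^sup>n - 1|\<close> to \<open>max 1 |a|\<^sup>n\<close> for every root \<open>a\<close>.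
\<close>

section \<open>Determinants over finite index sets\<close>

text \<open>The Leibniz formula over an arbitrary index set, so that vertices, and pairs of a vertex
  and a residue, index matrices without being ordered.\<close>

definition setdet :: "'i set \<Rightarrow> ('i \<Rightarrow> 'i \<Rightarrow> 'a :: comm_ring_1) \<Rightarrow> 'a" where
  "setdet V A = (\<Sum>\<pi> | \<pi> permutes V. of_int (sign \<pi>) * (\<Prod>v\<in>V. A v (\<pi> v)))"

lemma setdet_cong:
  assumes "\<And>v w. v \<in> V \<Longrightarrow> w \<in> V \<Longrightarrow> A v w = B v w"
  shows "setdet V A = setdet V B"
  unfolding setdet_def
  by (intro sum.cong refl arg_cong2[where f = "(*)"] prod.cong assms) (auto simp: permutes_in_image)

lemma setdet_eq_det: "setdet {0..<n} A = Determinant.det (mat n n (\<lambda>(i, j). A i j))"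
  unfolding setdet_def
  by (subst Determinant.det_def'[of _ n])
    (auto intro!: sum.cong prod.cong arg_cong2[where f = "(*)"] simp: permutes_in_image)

text \<open>Transporting permutations along \<open>f\<close> is a bijection that preserves signs, so
  the two Leibniz sums agree term by term. With an enumeration for \<open>f\<close>, results on
  ordinary matrices carry over.\<close>

lemma setdet_reindex:
  assumes f: "bij_betw f A B" and fin: "finite A"
  shows "setdet B M = setdet A (\<lambda>i j. M (f i) (f j))"
proof -
  have inj: "inj_on f A" and img: "f ` A = B" using f by (auto simp: bij_betw_def)
  have "bij_betw (map_permutation A f) {\<pi>. \<pi> permutes A} {\<pi>. \<pi> permutes B}"
    using bij_betw_permutations[OF f]
    by (rule iffD1[OF bij_betw_cong, rotated])
      (auto simp: map_permutation_def restrict_id_def fun_eq_iff img)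
  then have "setdet B M = (\<Sum>\<pi> | \<pi> permutes A.
      of_int (sign (map_permutation A f \<pi>)) * (\<Prod>v\<in>B. M v (map_permutation A f \<pi> v)))"
    unfolding setdet_def by (rule sum.reindex_bij_betw[symmetric])
  also have "\<dots> = (\<Sum>\<pi> | \<pi> permutes A. of_int (sign \<pi>) * (\<Prod>i\<in>A. M (f i) (f (\<pi> i))))"
  proof (rule sum.cong[OF refl])
    fix \<pi> assume "\<pi> \<in> {\<pi>. \<pi> permutes A}"
    then have \<pi>: "\<pi> permutes A" by simp
    have "(\<Prod>v\<in>B. M v (map_permutation A f \<pi> v)) = (\<Prod>i\<in>A. M (f i) (map_permutation A f \<pi> (f i)))"
      by (rule prod.reindex_bij_betw[OF f, symmetric])
    also have "\<dots> = (\<Prod>i\<in>A. M (f i) (f (\<pi> i)))"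
      by (rule prod.cong) (simp_all add: map_permutation_apply[OF inj])
    finally show "of_int (sign (map_permutation A f \<pi>)) * (\<Prod>v\<in>B. M v (map_permutation A f \<pi> v)) =
        of_int (sign \<pi>) * (\<Prod>i\<in>A. M (f i) (f (\<pi> i)))"
      by (simp add: sign_map_permutation[OF inj \<pi> fin])
  qed
  finally show ?thesis by (simp add: setdet_def)
qed

lemma setdet_enumerate:
  assumes "bij_betw f {0..<n} V"
  shows "setdet V M = Determinant.det (mat n n (\<lambda>(i, j). M (f i) (f j)))"
  using setdet_reindex[OF assms] by (simp add: setdet_eq_det)

lemma setdet_mult:
  assumes "finite V"
  shows "setdet V (\<lambda>u w. \<Sum>v\<in>V. A u v * B v w) = setdet V A * setdet V B"
proof -
  obtain f n where f: "bij_betw f {0..<n :: nat} V"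
    using ex_bij_betw_nat_finite[OF assms] by blast
  have "mat n n (\<lambda>(i, j). \<Sum>v\<in>V. A (f i) v * B v (f j)) =
      mat n n (\<lambda>(i, j). A (f i) (f j)) * mat n n (\<lambda>(i, j). B (f i) (f j))"
    by (intro eq_matI) (auto simp: scalar_prod_def sum.reindex_bij_betw[OF f, symmetric])
  then show ?thesis
    by (simp add: setdet_enumerate[OF f] Determinant.det_mult[where n = n])
qed

lemma setdet_eq_0_kernel:
  fixes A :: "'i \<Rightarrow> 'i \<Rightarrow> 'a :: idom"
  assumes fin: "finite V" and w: "w \<in> V" "u w \<noteq> 0"
    and ker: "\<And>v. v \<in> V \<Longrightarrow> (\<Sum>w\<in>V. A v w * u w) = 0"
  shows "setdet V A = 0"
proof -
  obtain f n where f: "bij_betw f {0..<n :: nat} V"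
    using ex_bij_betw_nat_finite[OF fin] by blast
  let ?M = "mat n n (\<lambda>(i, j). A (f i) (f j))" and ?x = "Matrix.vec n (\<lambda>i. u (f i))"
  obtain k where k: "k < n" "f k = w" using f w by (auto simp: bij_betw_def)
  have "?x $ k \<noteq> 0\<^sub>v n $ k" using k w by simp
  then have "?x \<noteq> 0\<^sub>v n" by metis
  moreover have "?M *\<^sub>v ?x = 0\<^sub>v n"
  proof (intro eq_vecI)
    fix i assume "i < dim_vec (0\<^sub>v n :: 'a Matrix.vec)"
    then have i: "i < n" by simp
    then have "f i \<in> V" using f by (auto simp: bij_betw_def)
    then have "(\<Sum>j = 0..<n. A (f i) (f j) * u (f j)) = 0"
      using ker[of "f i"] by (simp add: sum.reindex_bij_betw[OF f, symmetric])
    then show "(?M *\<^sub>v ?x) $ i = 0\<^sub>v n $ i" using i by (simp add: scalar_prod_def)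
  qed simp
  ultimately have "Determinant.det ?M = 0"
    by (subst Determinant.det_0_iff_vec_prod_zero[of _ n]) (auto intro!: exI[of _ ?x])
  then show ?thesis by (simp add: setdet_enumerate[OF f])
qed

lemma setdet_Un:
  fixes A :: "'i \<Rightarrow> 'i \<Rightarrow> 'a :: idom"
  assumes fin: "finite S" "finite T" and disj: "S \<inter> T = {}"
    and zero: "\<And>s t. s \<in> S \<Longrightarrow> t \<in> T \<Longrightarrow> A s t = 0"
  shows "setdet (S \<union> T) A = setdet S A * setdet T A"
proof -
  obtain f n where f: "bij_betw f {0..<n :: nat} S"
    using ex_bij_betw_nat_finite[OF fin(1)] by blast
  obtain g m where g: "bij_betw g {0..<m :: nat} T"
    using ex_bij_betw_nat_finite[OF fin(2)] by blast
  \<comment> \<open>Enumerating \<open>S\<close> first and \<open>T\<close> afterwards makes the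
    matrix block lower triangular.\<close>
  define h where "h i = (if i < n then f i else g (i - n))" for i
  have "bij_betw h {0..<n} S"
    using f by (rule iffD1[OF bij_betw_cong, rotated]) (simp add: h_def)
  moreover have "bij_betw h {n..<n + m} T"
  proof -
    have "bij_betw (\<lambda>i. i - n) {n..<n + m} {0..<m}"
      by (rule bij_betw_byWitness[where f' = "\<lambda>i. i + n"]) auto
    from bij_betw_trans[OF this g] show ?thesis
      by (rule iffD1[OF bij_betw_cong, rotated]) (simp add: h_def)
  qed
  ultimately have "bij_betw h ({0..<n} \<union> {n..<n + m}) (S \<union> T)"
    using disj by (intro bij_betw_combine)
  then have h: "bij_betw h {0..<n + m} (S \<union> T)"
    by (simp add: ivl_disj_un)
  have im1: "f i \<in> S" if "i < n" for i using f that by (auto simp: bij_betw_def)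
  have im2: "g j \<in> T" if "j < m" for j using g that by (auto simp: bij_betw_def)
  let ?A1 = "mat n n (\<lambda>(i, j). A (f i) (f j))" and ?A4 = "mat m m (\<lambda>(i, j). A (g i) (g j))"
  let ?A3 = "mat m n (\<lambda>(i, j). A (g i) (f j))"
  have "mat (n + m) (n + m) (\<lambda>(i, j). A (h i) (h j)) = four_block_mat ?A1 (0\<^sub>m n m) ?A3 ?A4"
    by (intro eq_matI) (auto simp: h_def intro!: zero im1 im2)
  moreover have "Determinant.det (four_block_mat ?A1 (0\<^sub>m n m) ?A3 ?A4) =
      Determinant.det ?A1 * Determinant.det ?A4"
    by (rule Determinant.det_four_block_mat_upper_right_zero) auto
  ultimately show ?thesis
    by (simp add: setdet_enumerate[OF f] setdet_enumerate[OF g] setdet_enumerate[OF h])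
qed

lemma setdet_empty [simp]: "setdet {} A = 1"
  by (simp add: setdet_def)

text \<open>The slices \<open>V \<times> {k}\<close> do not interact, so they split off one at a
  time.\<close>

lemma setdet_blocks:
  fixes B :: "'k \<Rightarrow> 'i \<Rightarrow> 'i \<Rightarrow> 'a :: idom"
  assumes V: "finite V" and Z: "finite Z"
  shows "setdet (V \<times> Z) (\<lambda>x y. if snd x = snd y then B (snd x) (fst x) (fst y) else 0) =
    (\<Prod>k\<in>Z. setdet V (B k))"
  using Z
proof induction
  case (insert k Z)
  let ?M = "\<lambda>x y. if snd x = snd y then B (snd x) (fst x) (fst y) else 0"
  have "V \<times> insert k Z = (V \<times> {k}) \<union> (V \<times> Z)" by auto
  then have "setdet (V \<times> insert k Z) ?M = setdet (V \<times> {k}) ?M * setdet (V \<times> Z) ?M"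
    using insert.hyps V by (simp only:, intro setdet_Un) auto
  moreover have "bij_betw (\<lambda>v. (v, k)) V (V \<times> {k})"
    by (auto simp: bij_betw_def inj_on_def)
  from setdet_reindex[OF this V, of ?M] have "setdet (V \<times> {k}) ?M = setdet V (B k)"
    by simp
  ultimately show ?case using insert by simp
qed simp

lemma setdet_hom:
  assumes "comm_ring_hom h"
  shows "h (setdet V A) = setdet V (\<lambda>v w. h (A v w))"
proof -
  interpret comm_ring_hom h by fact
  show ?thesis unfolding setdet_def by (simp add: hom_distribs)
qed


section \<open>Expansion of the Laplacian determinant over rooted forests\<close>

text \<open>A choice \<open>c\<close> gives each vertex an edge to follow, or \<open>None\<close> to
  make it a root. For finite \<open>V\<close>, a rank that drops along every chosen edge says that
  no directed cycle has been chosen.\<close>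

definition rooted :: "('e \<Rightarrow> 'v) \<Rightarrow> 'v set \<Rightarrow> ('v \<Rightarrow> 'e option) \<Rightarrow> bool" where
  "rooted trg V c \<longleftrightarrow> (\<exists>h :: 'v \<Rightarrow> nat. \<forall>v\<in>V. \<forall>e. c v = Some e \<longrightarrow> h (trg e) < h v)"

text \<open>One summand of row \<open>v\<close> of \<open>x + L\<close>, with \<open>L\<close> the
  Laplacian: \<open>None\<close> stands for the diagonal \<open>x\<close>, and each edge leaving
  \<open>v\<close> for its own contribution to \<open>L\<close>. A loop contributes a zero
  row.\<close>

definition choice_row :: "('e \<Rightarrow> 'v) \<Rightarrow> 'a :: comm_ring_1 \<Rightarrow> 'v \<Rightarrow> 'e option \<Rightarrow> 'v \<Rightarrow> 'a" where
  "choice_row trg x v d w =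
     (case d of None \<Rightarrow> (if w = v then x else 0)
      | Some e \<Rightarrow> (if w = v then 1 else 0) - (if w = trg e then 1 else 0))"

text \<open>Multilinearity in the rows: a summand is picked independently in each row.\<close>

lemma setdet_sum_rows:
  assumes "finite V" "\<And>v. v \<in> V \<Longrightarrow> finite (D v)"
  shows "setdet V (\<lambda>v w. \<Sum>d\<in>D v. m v d w) = (\<Sum>c\<in>PiE V D. setdet V (\<lambda>v w. m v (c v) w))"
proof -
  have "setdet V (\<lambda>v w. \<Sum>d\<in>D v. m v d w) =
      (\<Sum>\<pi> | \<pi> permutes V. of_int (sign \<pi>) * (\<Sum>c\<in>PiE V D. \<Prod>v\<in>V. m v (c v) (\<pi> v)))"
    unfolding setdet_def using assms by (simp add: prod_sum_PiE)
  also have "\<dots> = (\<Sum>c\<in>PiE V D. setdet V (\<lambda>v w. m v (c v) w))"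
    unfolding setdet_def sum_distrib_left by (rule sum.swap)
  finally show ?thesis .
qed

text \<open>Comparing the sums of the ranks over \<open>V\<close> and over the permuted \<open>V\<close> shows that only the
  identity permutation contributes to the determinant.\<close>

lemma setdet_choice_rooted:
  fixes c :: "'v \<Rightarrow> 'e option"
  assumes fin: "finite V" and c: "rooted trg V c"
  shows "setdet V (\<lambda>v w. choice_row trg x v (c v) w) = x ^ card {v \<in> V. c v = None}"
proof -
  let ?m = "\<lambda>v w. choice_row trg x v (c v) w"
  obtain h :: "'v \<Rightarrow> nat" where h: "\<And>v e. v \<in> V \<Longrightarrow> c v = Some e \<Longrightarrow> h (trg e) < h v"
    using c by (auto simp: rooted_def)
  have "(\<Prod>v\<in>V. ?m v (\<pi> v)) = 0" if \<pi>: "\<pi> permutes V" "\<pi> \<noteq> id" for \<pi>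
  proof (rule ccontr)
    assume "(\<Prod>v\<in>V. ?m v (\<pi> v)) \<noteq> 0"
    then have nz: "?m v (\<pi> v) \<noteq> 0" if "v \<in> V" for v
      using that fin by (meson prod_zero)
    \<comment> \<open>A nonzero entry off the diagonal can only sit at the target of the chosen
      edge, where the rank is smaller.\<close>
    have less: "h (\<pi> v) < h v" if "v \<in> V" "\<pi> v \<noteq> v" for v
      using nz[OF that(1)] that h by (auto simp: choice_row_def split: option.splits if_splits)
    obtain v where v: "\<pi> v \<noteq> v" using \<pi>(2) by (auto simp: fun_eq_iff)
    then have "v \<in> V" using \<pi>(1) by (meson permutes_not_in)
    then have "(\<Sum>v\<in>V. h (\<pi> v)) < (\<Sum>v\<in>V. h v)"
      using fin less v by (intro sum_strict_mono_ex1) force+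
    moreover have "(\<Sum>v\<in>V. h (\<pi> v)) = (\<Sum>v\<in>V. h v)"
      by (rule sum.reindex_bij_betw[OF permutes_imp_bij[OF \<pi>(1)]])
    ultimately show False by simp
  qed
  then have "setdet V ?m = (\<Sum>\<pi>\<in>{id}. of_int (sign \<pi>) * (\<Prod>v\<in>V. ?m v (\<pi> v)))"
    unfolding setdet_def
    by (intro sum.mono_neutral_right) (auto simp: finite_permutations fin permutes_id)
  also have "\<dots> = (\<Prod>v\<in>V. ?m v v)" by simp
  \<comment> \<open>The rank rules out chosen loops, so a chosen edge has diagonal entry 1.\<close>
  also have "\<dots> = (\<Prod>v\<in>V. if c v = None then x else 1)"
    by (intro prod.cong refl) (use h in \<open>force simp: choice_row_def split: option.splits\<close>)
  also have "\<dots> = x ^ card {v \<in> V. c v = None}"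
    using fin by (simp add: prod.If_cases Int_def conj_commute)
  finally show ?thesis .
qed

text \<open>The indicator function of the set of vertices from which no root is reached lies in the
  kernel.\<close>

lemma setdet_choice_not_rooted:
  fixes x :: "'a :: idom" and c :: "'v \<Rightarrow> 'e option"
  assumes fin: "finite V" and c: "\<not> rooted trg V c"
    and trg: "\<And>v e. v \<in> V \<Longrightarrow> c v = Some e \<Longrightarrow> trg e \<in> V"
  shows "setdet V (\<lambda>v w. choice_row trg x v (c v) w) = 0"
proof -
  define step where "step v = (case c v of None \<Rightarrow> v | Some e \<Rightarrow> trg e)" for v
  define U where "U = {v \<in> V. \<forall>n. c ((step ^^ n) v) \<noteq> None}"
  define u :: "'v \<Rightarrow> 'a" where "u v = (if v \<in> U then 1 else 0)" for v
  have step_Some: "(step ^^ Suc n) v = (step ^^ n) (trg e)" if "c v = Some e" for n v e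
    using that by (simp add: funpow_swap1 step_def)
  \<comment> \<open>Otherwise the number of steps needed to reach a root would be a rank for
    \<open>c\<close>.\<close>
  have "U \<noteq> {}"
  proof
    assume "U = {}"
    then have ex: "\<exists>n. c ((step ^^ n) v) = None" if "v \<in> V" for v
      using that by (auto simp: U_def)
    define h where "h v = (LEAST n. c ((step ^^ n) v) = None)" for v
    have "h (trg e) < h v" if "v \<in> V" "c v = Some e" for v e
    proof -
      have "c ((step ^^ h v) v) = None" unfolding h_def using LeastI_ex[OF ex[OF that(1)]] .
      moreover from this have "h v \<noteq> 0" using that(2) by (cases "h v") auto
      then obtain k where k: "h v = Suc k" by (cases "h v") auto
      ultimately have "c ((step ^^ k) (trg e)) = None" using step_Some[OF that(2)] by metis
      then have "h (trg e) \<le> k" unfolding h_def by (rule Least_le)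
      then show ?thesis using k by simp
    qed
    then have "rooted trg V c" unfolding rooted_def by (intro exI[of _ h]) auto
    then show False using c by simp
  qed
  then obtain v where v: "v \<in> U" by blast
  \<comment> \<open>As \<open>v\<close> is not a root itself, dropping the step number 0 does not
    change whether a root is ever reached; hence \<open>u\<close> is constant along chosen
    edges.\<close>
  have U_Some: "v \<in> U \<longleftrightarrow> trg e \<in> U" if "v \<in> V" "c v = Some e" for v e
  proof -
    have "(\<forall>n. P n) \<longleftrightarrow> (\<forall>n. P (Suc n))" if "P 0" for P :: "nat \<Rightarrow> bool"
      using that by (metis not0_implies_Suc)
    from this[of "\<lambda>n. c ((step ^^ n) v) \<noteq> None"]
    have "(\<forall>n. c ((step ^^ n) v) \<noteq> None) \<longleftrightarrow> (\<forall>n. c ((step ^^ n) (trg e)) \<noteq> None)"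
      using that(2) step_Some[OF that(2)] by simp
    then show ?thesis using that trg by (auto simp: U_def)
  qed
  have "(\<Sum>w\<in>V. choice_row trg x v (c v) w * u w) = 0" if v: "v \<in> V" for v
  proof (cases "c v")
    case None
    then have "v \<notin> U" using funpow_0[of step v] unfolding U_def by (metis (mono_tags, lifting) mem_Collect_eq)
    then have "choice_row trg x v (c v) w * u w = 0" for w
      using None by (auto simp: choice_row_def u_def)
    then show ?thesis by (simp only: sum.neutral_const)
  next
    case (Some e)
    then have "(\<Sum>w\<in>V. choice_row trg x v (c v) w * u w) =
        (\<Sum>w\<in>V. (if w = v then u w else 0) - (if w = trg e then u w else 0))"
      by (intro sum.cong) (auto simp: choice_row_def)
    also have "\<dots> = u v - u (trg e)"
      using fin v trg[OF v Some] by (simp add: sum_subtractf)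
    also have "\<dots> = 0" using U_Some[OF v Some] by (simp add: u_def)
    finally show ?thesis .
  qed
  then show ?thesis
    using v by (intro setdet_eq_0_kernel[OF fin, of v u]) (auto simp: u_def U_def)
qed

text \<open>Spanning trees directed towards \<open>r\<close>: each other vertex keeps one outgoing
  edge, and the rank excludes cycles. Extensionality makes equality of choice functions the equality
  of choices.\<close>

definition arborescences :: "('e \<Rightarrow> 'v) \<Rightarrow> 'v set \<Rightarrow> ('v \<Rightarrow> 'e set) \<Rightarrow> 'v \<Rightarrow> ('v \<Rightarrow> 'e) set" where
  "arborescences trg V E r =
     {c \<in> PiE (V - {r}) E. \<exists>h :: 'v \<Rightarrow> nat. \<forall>v\<in>V - {r}. h (trg (c v)) < h v}"

lemma card_rooted_single:
  fixes V :: "'v set" and E :: "'v \<Rightarrow> 'e set"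
  assumes fin: "finite V" "\<And>v. v \<in> V \<Longrightarrow> finite (E v)"
  shows "card {c \<in> PiE V (\<lambda>v. insert None (Some ` E v)). rooted trg V c \<and> card {v \<in> V. c v = None} = 1}
    = (\<Sum>r\<in>V. card (arborescences trg V E r))"
proof -
  let ?R = "{c \<in> PiE V (\<lambda>v. insert None (Some ` E v)). rooted trg V c \<and> card {v \<in> V. c v = None} = 1}"
  \<comment> \<open>The two directions of the bijection: \<open>f\<close> records the root as
    \<open>None\<close>, and \<open>g\<close> recovers the root as the only vertex with
    \<open>None\<close>.\<close>
  define f where "f = (\<lambda>(r, c). \<lambda>v\<in>V. if v = r then None else Some (c v :: 'e))"
  define g where "g c = (let r = THE v. v \<in> V \<and> c v = None in (r, \<lambda>v\<in>V - {r}. the (c v :: 'e option)))"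
    for c
  have "bij_betw f (Sigma V (arborescences trg V E)) ?R"
  proof (rule bij_betw_byWitness[where f' = g])
    have "g (f (r, c)) = (r, c)" if "r \<in> V" "c \<in> arborescences trg V E r" for r c
    proof -
      have "(THE v. v \<in> V \<and> f (r, c) v = None) = r"
        using that by (intro the_equality) (auto simp: f_def split: if_splits)
      moreover have "(\<lambda>v\<in>V - {r}. the (f (r, c) v)) = c"
        using that by (intro ext) (auto simp: f_def arborescences_def PiE_def extensional_def restrict_def)
      ultimately show ?thesis by (simp add: g_def Let_def)
    qed
    then show "\<forall>x\<in>Sigma V (arborescences trg V E). g (f x) = x" by auto
    have g: "g c \<in> Sigma V (arborescences trg V E) \<and> f (g c) = c" if "c \<in> ?R" for c
    proof -
      from that have c: "c \<in> PiE V (\<lambda>v. insert None (Some ` E v))" "rooted trg V c"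
        and "card {v \<in> V. c v = None} = 1" by auto
      then obtain r where r: "{v \<in> V. c v = None} = {r}" by (auto simp: card_1_singleton_iff)
      then have not_None: "c v \<noteq> None" if "v \<in> V - {r}" for v
        using that by auto
      from r have rV: "r \<in> V" "c r = None" by auto
      from r have the: "(THE v. v \<in> V \<and> c v = None) = r" by (intro the_equality) auto
      obtain h :: "'v \<Rightarrow> nat" where h: "\<And>v e. v \<in> V \<Longrightarrow> c v = Some e \<Longrightarrow> h (trg e) < h v"
        using c(2) by (auto simp: rooted_def)
      have "the (c v) \<in> E v" "h (trg (the (c v))) < h v" if "v \<in> V - {r}" for v
        using not_None[OF that] that c(1) h[of v] by (auto simp: PiE_def Pi_def)
      then have "g c \<in> Sigma V (arborescences trg V E)"
        using rV by (auto simp: g_def Let_def the arborescences_def intro!: exI[of _ h])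
      moreover have "f (g c) v = c v" for v
        using not_None[of v] rV c(1) by (auto simp: g_def f_def Let_def the PiE_def extensional_def)
      ultimately show ?thesis by blast
    qed
    then show "\<forall>c\<in>?R. f (g c) = c" and "g ` ?R \<subseteq> Sigma V (arborescences trg V E)" by blast+
    have "f (r, c) \<in> ?R" if r: "r \<in> V" and c: "c \<in> arborescences trg V E r" for r c
    proof -
      obtain h :: "'v \<Rightarrow> nat" where h: "\<And>v. v \<in> V - {r} \<Longrightarrow> h (trg (c v)) < h v"
        using c by (auto simp: arborescences_def)
      have "rooted trg V (f (r, c))"
        unfolding rooted_def using h by (intro exI[of _ h]) (auto simp: f_def split: if_splits)
      moreover have "{v \<in> V. f (r, c) v = None} = {r}" using r by (auto simp: f_def split: if_splits)
      ultimately show ?thesis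
        using c by (auto simp: f_def arborescences_def PiE_def Pi_def)
    qed
    then show "f ` Sigma V (arborescences trg V E) \<subseteq> ?R" by auto
  qed
  then have "card ?R = card (Sigma V (arborescences trg V E))"
    by (simp add: bij_betw_same_card)
  also have "finite (arborescences trg V E r)" if "r \<in> V" for r
    unfolding arborescences_def
    by (rule finite_subset[OF _ finite_PiE[of "V - {r}" E]]) (use fin in auto)
  then have "card (Sigma V (arborescences trg V E)) = (\<Sum>r\<in>V. card (arborescences trg V E r))"
    using fin by simp
  finally show ?thesis .
qed

text \<open>Expanding all rows of \<open>x + L\<close> leaves one power of \<open>x\<close> per
  rooted choice, with the number of roots as exponent. The linear coefficient therefore counts the
  choices with a single root.\<close>

lemma coeff_1_setdet_laplacian:
  assumes fin: "finite V" "\<And>v. v \<in> V \<Longrightarrow> finite (E v)"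
    and trg: "\<And>v e. v \<in> V \<Longrightarrow> e \<in> E v \<Longrightarrow> trg e \<in> V"
  shows "poly.coeff (setdet V (\<lambda>v w. (if v = w then [:0, 1:] + of_nat (card (E v)) else 0)
      - of_nat (card {e \<in> E v. trg e = w}) :: 'b :: idom poly)) 1
    = of_nat (\<Sum>r\<in>V. card (arborescences trg V E r))"
proof -
  let ?D = "\<lambda>v. insert None (Some ` E v)"
  let ?X = "[:0, 1:] :: 'b poly"
  have "(if v = w then ?X + of_nat (card (E v)) else 0) - of_nat (card {e \<in> E v. trg e = w})
      = (\<Sum>d\<in>?D v. choice_row trg ?X v d w)" if "v \<in> V" for v w
  proof -
    have "(\<Sum>d\<in>?D v. choice_row trg ?X v d w) = choice_row trg ?X v None w
        + (\<Sum>e\<in>E v. choice_row trg ?X v (Some e) w)"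
      using fin(2)[OF that] by (subst sum.insert) (auto simp: sum.reindex)
    also have "(\<Sum>e\<in>E v. choice_row trg ?X v (Some e) w) =
        (\<Sum>e\<in>E v. if w = v then 1 else 0) - (\<Sum>e\<in>E v. if w = trg e then 1 else 0)"
      by (simp add: choice_row_def sum_subtractf)
    also have "(\<Sum>e\<in>E v. if w = trg e then 1 else 0 :: 'b poly) = of_nat (card {e \<in> E v. trg e = w})"
      using fin(2)[OF that] by (simp add: sum.If_cases Int_def eq_commute)
    finally show ?thesis by (simp add: choice_row_def)
  qed
  then have "setdet V (\<lambda>v w. (if v = w then ?X + of_nat (card (E v)) else 0)
      - of_nat (card {e \<in> E v. trg e = w})) = setdet V (\<lambda>v w. \<Sum>d\<in>?D v. choice_row trg ?X v d w)"
    by (intro setdet_cong)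
  also have "\<dots> = (\<Sum>c\<in>PiE V ?D. setdet V (\<lambda>v w. choice_row trg ?X v (c v) w))"
    using fin by (intro setdet_sum_rows) auto
  also have "\<dots> = (\<Sum>c\<in>PiE V ?D. if rooted trg V c then ?X ^ card {v \<in> V. c v = None} else 0)"
  proof (rule sum.cong[OF refl])
    fix c assume c: "c \<in> PiE V ?D"
    have "trg e \<in> V" if "v \<in> V" "c v = Some e" for v e
      using c that trg[of v e] by (force simp: PiE_def Pi_def)
    then show "setdet V (\<lambda>v w. choice_row trg ?X v (c v) w) =
        (if rooted trg V c then ?X ^ card {v \<in> V. c v = None} else 0)"
      by (simp add: setdet_choice_rooted setdet_choice_not_rooted fin)
  qed
  finally have "poly.coeff (setdet V (\<lambda>v w. (if v = w then ?X + of_nat (card (E v)) else 0)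
      - of_nat (card {e \<in> E v. trg e = w}))) 1 =
      (\<Sum>c\<in>PiE V ?D. if rooted trg V c \<and> card {v \<in> V. c v = None} = 1 then 1 else 0)"
    by (auto simp: coeff_sum monom_altdef[where c = 1, simplified, symmetric] intro!: sum.cong)
  also have "\<dots> = of_nat (card {c \<in> PiE V ?D. rooted trg V c \<and> card {v \<in> V. c v = None} = 1})"
    using fin by (subst sum.If_cases) (auto intro!: finite_PiE simp: Int_def)
  finally show ?thesis by (simp only: card_rooted_single[OF fin])
qed


section \<open>Arborescences and spanning trees\<close>

text \<open>Spanning trees are sets closed under inversion, so both orientations of every chosen
  edge are taken.\<close>

definition edge_closure :: "('v, 'e) pre_digraph \<Rightarrow> ('e \<Rightarrow> 'e) \<Rightarrow> 'v \<Rightarrow> ('v \<Rightarrow> 'e) \<Rightarrow> 'e set" where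
  "edge_closure X bar r c = (\<Union>v\<in>verts X - {r}. {c v, bar (c v)})"

text \<open>For a closed walk (\<open>u = v\<close>) the four parts together give each of its edges
  a preceding and a following edge on the walk, cyclically.\<close>

lemma (in pre_digraph) cas_pred:
  assumes "cas u p v" "p \<noteq> []"
  shows "\<exists>e\<in>set p. head G e = v"
    and "e \<in> set p \<Longrightarrow> tail G e = u \<or> (\<exists>e'\<in>set p. head G e' = tail G e)"
    and "e \<in> set p \<Longrightarrow> head G e = v \<or> (\<exists>e'\<in>set p. tail G e' = head G e)"
    and "\<exists>e\<in>set p. tail G e = u"
  using assms
proof (induction p arbitrary: u)
  case (Cons d p)
  { case 1 then show ?case using Cons.IH(1)[of "head G d"] by (cases p) auto }
  { case 2 then show ?case using Cons.IH(2)[of "head G d"] by (cases p) auto }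
  { case 3 then show ?case using Cons.IH(3,4)[of "head G d"] by (cases p) auto }
  { case 4 then show ?case by auto }
qed simp_all

text \<open>Traversing an edge backwards later on would return to its tail, but a path does not
  repeat vertices.\<close>

lemma (in bidirected_digraph) arev_notin_apath:
  assumes "cas u p v" "distinct (awalk_verts u p)" "set p \<subseteq> arcs G" "e \<in> set p"
  shows "arev e \<notin> set p"
  using assms
proof (induction p arbitrary: u)
  case (Cons d p)
  have d: "d \<in> arcs G" "cas (head G d) p v" "tail G d \<notin> set (awalk_verts (head G d) p)"
    using Cons.prems by auto
  have "arev d \<notin> set p"
    using d set_awalk_verts_cas[OF d(2)] head_arev[OF d(1)] by force
  moreover have "arev d \<noteq> d" using d(1) by (simp add: arev_dom)
  moreover have "arev e \<notin> set p \<and> arev e \<noteq> d" if "e \<in> set p"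
    using Cons.IH[OF d(2)] Cons.prems that \<open>arev d \<notin> set p\<close> by auto
  ultimately show ?case
    using Cons.prems(4) by auto
qed simp

context
  fixes X :: "('v, 'e) pre_digraph" and bar :: "'e \<Rightarrow> 'e" and r :: 'v
  assumes graph: "bidirected_digraph X bar" "fin_digraph X" and r: "r \<in> verts X"
begin

interpretation bidirected_digraph X bar by (fact graph)
interpretation fin_digraph X by (fact graph)

abbreviation "arbs \<equiv> arborescences (head X) (verts X) (out_arcs X) r"

lemma edge_closure_subset:
  assumes "c \<in> arbs"
  shows "edge_closure X bar r c \<subseteq> arcs X" "e \<in> edge_closure X bar r c \<Longrightarrow> bar e \<in> edge_closure X bar r c"
  using assms by (auto simp: arborescences_def edge_closure_def PiE_def Pi_def)

lemma wf_digraph_arcs_update: "T \<subseteq> arcs X \<Longrightarrow> wf_digraph (X\<lparr>arcs := T\<rparr>)"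
  by unfold_locales (auto intro: wellformed)

text \<open>By induction on the rank, the chosen edges lead from every vertex down to
  \<open>r\<close>, and their inverses lead back.\<close>

lemma edge_closure_strongly_connected:
  assumes c: "c \<in> arbs"
  shows "strongly_connected (X\<lparr>arcs := edge_closure X bar r c\<rparr>)"
proof -
  let ?T = "edge_closure X bar r c"
  let ?Y = "X\<lparr>arcs := ?T\<rparr>"
  interpret Y: wf_digraph ?Y by (intro wf_digraph_arcs_update edge_closure_subset c)
  obtain h :: "'v \<Rightarrow> nat" where h: "\<And>v. v \<in> verts X - {r} \<Longrightarrow> h (head X (c v)) < h v"
    using c by (auto simp: arborescences_def)
  have cv: "c v \<in> arcs X" "tail X (c v) = v" if "v \<in> verts X - {r}" for v
    using c that by (auto simp: arborescences_def PiE_def Pi_def)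
  have "v \<rightarrow>\<^sup>*\<^bsub>?Y\<^esub> r \<and> r \<rightarrow>\<^sup>*\<^bsub>?Y\<^esub> v" if "v \<in> verts X" for v
    using that
  proof (induction "h v" arbitrary: v rule: less_induct)
    case less
    show ?case
    proof (cases "v = r")
      case False
      then have v: "v \<in> verts X - {r}" using less.prems by simp
      let ?w = "head X (c v)"
      have "?w \<in> verts X" using cv[OF v] by auto
      then have IH: "?w \<rightarrow>\<^sup>*\<^bsub>?Y\<^esub> r" "r \<rightarrow>\<^sup>*\<^bsub>?Y\<^esub> ?w" using less.hyps[OF h[OF v]] by auto
      have "c v \<in> arcs ?Y" "bar (c v) \<in> arcs ?Y" using v by (auto simp: edge_closure_def)
      from this[THEN Y.in_arcs_imp_in_arcs_ends] have "v \<rightarrow>\<^bsub>?Y\<^esub> ?w" "?w \<rightarrow>\<^bsub>?Y\<^esub> v"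
        using cv[OF v] by simp_all
      then show ?thesis using IH Y.adj_reachable_trans[of v ?w r] Y.reachable_adj_trans[of r ?w v]
        by blast
    qed (use r in simp)
  qed
  then show ?thesis
    using r by (intro strongly_connectedI) (auto intro: Y.reachable_trans)
qed

text \<open>At a vertex of maximal height, a circuit would have to enter and leave along the same edge.\<close>

lemma edge_closure_no_circuit:
  assumes c: "c \<in> arbs"
  shows "\<not> circuit (X\<lparr>arcs := edge_closure X bar r c\<rparr>) bar p"
proof
  let ?T = "edge_closure X bar r c"
  let ?Y = "X\<lparr>arcs := ?T\<rparr>"
  interpret Y: wf_digraph ?Y by (intro wf_digraph_arcs_update edge_closure_subset c)
  assume "circuit ?Y bar p"
  then obtain u where u: "Y.cas u p u" "p \<noteq> []" "set p \<subseteq> ?T"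
    and bar: "\<And>e. e \<in> set p \<Longrightarrow> bar e \<notin> set p"
    by (auto simp: circuit_def Y.cycle_def Y.awalk_def)
  obtain h :: "'v \<Rightarrow> nat" where h: "\<And>v. v \<in> verts X - {r} \<Longrightarrow> h (head X (c v)) < h v"
    using c by (auto simp: arborescences_def)
  have cv: "c v \<in> arcs X" "tail X (c v) = v" if "v \<in> verts X - {r}" for v
    using c that by (auto simp: arborescences_def PiE_def Pi_def)
  have "Max ((\<lambda>e. h (tail X e)) ` set p) \<in> (\<lambda>e. h (tail X e)) ` set p"
    using u(2) by (intro Max_in) auto
  then obtain e where e: "e \<in> set p" "h (tail X e) = Max ((\<lambda>e. h (tail X e)) ` set p)" by auto
  have max: "h (tail X d) \<le> h (tail X e)" if "d \<in> set p" for d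
    unfolding e(2) using that by (intro Max_ge) auto
  obtain e' where e': "e' \<in> set p" "head X e' = tail X e"
    using Y.cas_pred(1)[OF u(1,2)] Y.cas_pred(2)[OF u(1,2) e(1)] by fastforce
  obtain e'' where e'': "e'' \<in> set p" "tail X e'' = head X e"
    using Y.cas_pred(4)[OF u(1,2)] Y.cas_pred(3)[OF u(1,2) e(1)] by fastforce
  obtain x where x: "x \<in> verts X - {r}" "e = c x \<or> e = bar (c x)"
    using e(1) u(3) by (auto simp: edge_closure_def)
  obtain y where y: "y \<in> verts X - {r}" "e' = c y \<or> e' = bar (c y)"
    using e'(1) u(3) by (auto simp: edge_closure_def)
  \<comment> \<open>The circuit must leave its highest vertex downwards and enter it from below:
    \<open>e = bar (c x)\<close> or \<open>e' = c y\<close> would put a vertex on the circuit that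
    is higher still. So both edges belong to the choice at that vertex, and they are inverse to each
    other.\<close>
  have "e \<noteq> bar (c x)" using h[OF x(1)] cv[OF x(1)] max[OF e''(1)] e''(2) by auto
  then have "e = c x" using x by blast
  moreover have "e' \<noteq> c y" using h[OF y(1)] cv[OF y(1)] max[OF e'(1)] e'(2) by auto
  then have "e' = bar (c y)" using y by blast
  moreover from this have "y = x" using cv[OF x(1)] cv[OF y(1)] e'(2) \<open>e = c x\<close> by simp
  ultimately show False using bar[OF e(1)] e'(1) by simp
qed

lemma edge_closure_spanning_tree:
  assumes "c \<in> arbs"
  shows "edge_closure X bar r c \<in> spanning_trees X bar"
  using edge_closure_subset[OF assms] edge_closure_strongly_connected[OF assms]
    edge_closure_no_circuit[OF assms]
  by (auto simp: spanning_trees_def is_tree_def)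

text \<open>Let \<open>v\<close> be the highest vertex, with respect to \<open>h\<close>, at which
  the choices differ. Then \<open>c' v\<close> is the inverse of some \<open>c w\<close> with
  \<open>w\<close> higher than \<open>v\<close>, so \<open>c' w = c w\<close>. Now \<open>c'\<close>
  leads from \<open>v\<close> to \<open>w\<close> and back, against its rank
  \<open>h'\<close>.\<close>

lemma inj_on_edge_closure: "inj_on (edge_closure X bar r) arbs"
proof (rule inj_onI, rule ccontr)
  fix c c' assume c: "c \<in> arbs" and c': "c' \<in> arbs"
    and eq: "edge_closure X bar r c = edge_closure X bar r c'" and "c \<noteq> c'"
  obtain h :: "'v \<Rightarrow> nat" where h: "\<And>v. v \<in> verts X - {r} \<Longrightarrow> h (head X (c v)) < h v"
    using c by (auto simp: arborescences_def)
  obtain h' :: "'v \<Rightarrow> nat" where h': "\<And>v. v \<in> verts X - {r} \<Longrightarrow> h' (head X (c' v)) < h' v"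
    using c' by (auto simp: arborescences_def)
  have cv: "c v \<in> arcs X" "tail X (c v) = v" if "v \<in> verts X - {r}" for v
    using c that by (auto simp: arborescences_def PiE_def Pi_def)
  have cv': "c' v \<in> arcs X" "tail X (c' v) = v" if "v \<in> verts X - {r}" for v
    using c' that by (auto simp: arborescences_def PiE_def Pi_def)
  define S where "S = {v \<in> verts X - {r}. c v \<noteq> c' v}"
  have "S \<noteq> {}"
  proof
    assume "S = {}"
    then have "c v = c' v" for v
      using c c' by (cases "v \<in> verts X - {r}") (auto simp: S_def arborescences_def PiE_def extensional_def)
    then show False using \<open>c \<noteq> c'\<close> by auto
  qed
  moreover have "finite S" by (simp add: S_def)
  ultimately have "Max (h ` S) \<in> h ` S" by (intro Max_in) auto
  then obtain v where v: "v \<in> S" "h v = Max (h ` S)" by auto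
  have max: "h w \<le> h v" if "w \<in> S" for w
    unfolding v(2) using that \<open>finite S\<close> by (intro Max_ge) auto
  have vX: "v \<in> verts X - {r}" and neq: "c v \<noteq> c' v" using v by (auto simp: S_def)
  have "c' v \<in> edge_closure X bar r c" unfolding eq using vX by (auto simp: edge_closure_def)
  then obtain w where w: "w \<in> verts X - {r}" "c' v = c w \<or> c' v = bar (c w)"
    by (auto simp: edge_closure_def)
  have "c' v \<noteq> c w" using neq cv[OF w(1)] cv'[OF vX] by metis
  then have cw: "c' v = bar (c w)" using w by blast
  then have "head X (c w) = v" using cv[OF w(1)] cv'[OF vX] by simp
  moreover from this have "w \<notin> S" using h[OF w(1)] max by force
  then have "c w = c' w" using w(1) by (auto simp: S_def)
  moreover have "head X (c' v) = w" using cw cv[OF w(1)] by simp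
  ultimately show False using h'[OF vX] h'[OF w(1)] by simp
qed

text \<open>The first edges of shortest walks to \<open>r\<close> inside \<open>T\<close> form an
  arborescence. Its closure exhausts \<open>T\<close>, since any further edge of \<open>T\<close>
  would close a circuit with a path in the closure.\<close>

lemma spanning_tree_edge_closure:
  assumes T: "T \<in> spanning_trees X bar"
  shows "T \<in> edge_closure X bar r ` arbs"
proof -
  let ?Y = "X\<lparr>arcs := T\<rparr>"
  have TX: "T \<subseteq> arcs X" and Tbar: "\<And>e. e \<in> T \<Longrightarrow> bar e \<in> T"
    and conn: "strongly_connected ?Y" and no_circuit: "\<And>p. \<not> circuit ?Y bar p"
    using T by (auto simp: spanning_trees_def is_tree_def)
  interpret Y: wf_digraph ?Y by (intro wf_digraph_arcs_update TX)
  \<comment> \<open>The distance to \<open>r\<close> inside \<open>T\<close>, which also serves as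
    the rank.\<close>
  define d where "d v = (LEAST n. \<exists>p. Y.awalk v p r \<and> length p = n)" for v
  have "\<exists>e. e \<in> T \<and> tail X e = v \<and> d (head X e) < d v" if v: "v \<in> verts X - {r}" for v
  proof -
    have "v \<rightarrow>\<^sup>*\<^bsub>?Y\<^esub> r" using conn v r by (auto simp: strongly_connected_def)
    then have "\<exists>n p. Y.awalk v p r \<and> length p = n" by (simp add: Y.reachable_awalk)
    then have "\<exists>p. Y.awalk v p r \<and> length p = d v" unfolding d_def by (rule LeastI_ex)
    then obtain p where p: "Y.awalk v p r" "length p = d v" by blast
    moreover have "p \<noteq> []" using p(1) v by (auto simp: Y.awalk_Nil_iff)
    ultimately obtain e q where eq: "p = e # q" by (cases p) auto
    then have "Y.awalk (head X e) q r" using p(1) by (simp add: Y.awalk_Cons_iff)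
    then have "d (head X e) \<le> length q" unfolding d_def by (intro Least_le) auto
    then show ?thesis using p eq by (auto simp: Y.awalk_Cons_iff)
  qed
  then obtain c0 where c0: "\<And>v. v \<in> verts X - {r} \<Longrightarrow>
      c0 v \<in> T \<and> tail X (c0 v) = v \<and> d (head X (c0 v)) < d v" by metis
  define c where "c = restrict c0 (verts X - {r})"
  have c: "c v \<in> T" "tail X (c v) = v" "d (head X (c v)) < d v" if "v \<in> verts X - {r}" for v
    using c0[OF that] that by (auto simp: c_def)
  have arb: "c \<in> arbs"
    using c TX by (auto simp: arborescences_def PiE_def Pi_def c_def intro!: exI[of _ d])
  let ?S = "edge_closure X bar r c"
  let ?Z = "X\<lparr>arcs := ?S\<rparr>"
  interpret Z: wf_digraph ?Z by (intro wf_digraph_arcs_update edge_closure_subset arb)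
  have S: "?S \<subseteq> T" using c Tbar by (auto simp: edge_closure_def)
  have comp: "compatible ?Z ?Y" "compatible ?Y X" by (auto simp: compatible_def)
  have "T \<subseteq> ?S"
  proof (rule ccontr)
    assume "\<not> T \<subseteq> ?S"
    then obtain e where e: "e \<in> T" "e \<notin> ?S" by auto
    then have eX: "e \<in> arcs X" using TX by auto
    have bar_e: "bar e \<notin> ?S" using edge_closure_subset(2)[OF arb, of "bar e"] e by auto
    have "head X e \<rightarrow>\<^sup>*\<^bsub>?Z\<^esub> tail X e"
      using edge_closure_strongly_connected[OF arb] eX by (auto simp: strongly_connected_def)
    \<comment> \<open>A walk without repeated vertices is needed: it makes \<open>e # p\<close> a
      cycle and rules out that an edge and its inverse both occur.\<close>
    then obtain p where "Z.apath (head X e) p (tail X e)" by (auto simp: Z.reachable_apath)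
    then have p: "Z.cas (head X e) p (tail X e)" "distinct (Z.awalk_verts (head X e) p)" "set p \<subseteq> ?S"
      by (auto simp: Z.apath_def Z.awalk_def)
    have p': "Y.cas (head X e) p (tail X e)" "distinct (Y.awalk_verts (head X e) p)"
        "cas (head X e) p (tail X e)" "distinct (awalk_verts (head X e) p)"
      using p(1,2) by (simp_all add: compatible_cas[OF comp(1)] compatible_cas[OF comp(2)]
          compatible_awalk_verts[OF comp(1)] compatible_awalk_verts[OF comp(2)])
    have "Y.cycle (e # p)"
      unfolding Y.cycle_def Y.awalk_def
      using p' p(3) S e eX by (auto intro!: exI[of _ "tail X e"])
    moreover have "bar x \<notin> set (e # p)" if "x \<in> set (e # p)" for x
    proof (cases "x = e")
      case True
      then show ?thesis using bar_e p(3) arev_neq[OF eX] by auto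
    next
      case False
      then have x: "x \<in> set p" using that by simp
      then have "bar x \<notin> set p"
        using arev_notin_apath[OF p'(3,4) _ x] p(3) edge_closure_subset(1)[OF arb] by auto
      moreover have "bar x \<noteq> e" using x p(3) bar_e by (metis arev_arev subsetD)
      ultimately show ?thesis by simp
    qed
    ultimately show False using no_circuit[of "e # p"] by (auto simp: circuit_def)
  qed
  then show ?thesis using S arb by auto
qed

lemma card_arborescences_eq_num_spanning_trees: "card arbs = num_spanning_trees X bar"
proof -
  have "bij_betw (edge_closure X bar r) arbs (spanning_trees X bar)"
    unfolding bij_betw_def
    using inj_on_edge_closure edge_closure_spanning_tree spanning_tree_edge_closure by blast
  then show ?thesis by (simp add: bij_betw_same_card num_spanning_trees_def)
qed

end


section \<open>Spanning trees of cyclic covers\<close>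

text \<open>Every root contributes the same number of arborescences, hence the factor
  \<open>card (verts X)\<close>. The linear coefficient of \<open>det (x + L)\<close> is used in
  place of a cofactor because it can be read off from a factorisation of the determinant.\<close>

theorem matrix_tree:
  fixes X :: "('v, 'e) pre_digraph"
  assumes graph: "bidirected_digraph X bar" "fin_digraph X"
  shows "poly.coeff (setdet (verts X) (\<lambda>v w.
      (if v = w then [:0, 1:] + of_nat (card (out_arcs X v)) else 0)
      - of_nat (card {e \<in> out_arcs X v. head X e = w}) :: 'b :: idom poly)) 1
    = of_nat (card (verts X) * num_spanning_trees X bar)"
proof -
  interpret bidirected_digraph X bar by fact
  interpret fin_digraph X by fact
  show ?thesis
    by (subst coeff_1_setdet_laplacian)
      (auto simp: card_arborescences_eq_num_spanning_trees[OF graph])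
qed

definition twisted_laplacian ::
    "('v, 'e) pre_digraph \<Rightarrow> ('e \<Rightarrow> int) \<Rightarrow> 'a \<Rightarrow> 'v \<Rightarrow> 'v \<Rightarrow> 'a :: field" where
  "twisted_laplacian X \<alpha> z v w =
     (if v = w then of_nat (card (out_arcs X v)) else 0)
     - (\<Sum>e | e \<in> out_arcs X v \<and> head X e = w. z powi \<alpha> e)"

section \<open>Roots of unity and block-circulant determinants\<close>

lemma power_int_mod_root_of_unity:
  fixes z :: "'a :: field"
  assumes "z ^ n = 1" "n > 0"
  shows "z powi (k mod int n) = z powi k"
proof -
  have "z \<noteq> 0" using assms by (auto simp: power_0_left)
  have "z powi k = z powi (int n * (k div int n) + k mod int n)" by simp
  also have "\<dots> = z powi (int n * (k div int n)) * z powi (k mod int n)"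
    using \<open>z \<noteq> 0\<close> by (subst power_int_add) auto
  also have "z powi (int n * (k div int n)) = 1"
    unfolding power_int_mult using assms(1) by simp
  finally show ?thesis by simp
qed

lemma sum_powers_root_of_unity:
  fixes z :: "'a :: field"
  assumes "z ^ n = 1"
  shows "(\<Sum>i<n. z ^ i) = (if z = 1 then of_nat n else 0)"
  using assms by (simp add: geometric_sum)

lemma setdet_scalar:
  assumes "finite V"
  shows "setdet V (\<lambda>v w. if w = v then x else 0) = x ^ card V"
  \<comment> \<open>Making every vertex a root turns the choice rows into the scalar matrix.\<close>
  using setdet_choice_rooted[OF assms, of undefined "\<lambda>_. None" x]
  by (simp add: rooted_def choice_row_def)

lemma setdet_eval_poly:
  fixes M :: "'i \<Rightarrow> 'i \<Rightarrow> 'a :: comm_ring_1 poly"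
  shows "poly (setdet V M) a = setdet V (\<lambda>v w. poly (M v w) a)"
  by (rule setdet_hom) (unfold_locales; simp)

lemma coeff_setdet_0:
  "poly.coeff (setdet V M) 0 = setdet V (\<lambda>v w. poly.coeff (M v w) 0)"
  using setdet_eval_poly[of V M 0] by (simp add: poly_0_coeff_0)

text \<open>The discrete Fourier transform over the cyclic group block-diagonalises a block-circulant
  matrix.\<close>

lemma setdet_block_circulant:
  fixes M :: "'v \<times> int \<Rightarrow> 'v \<times> int \<Rightarrow> 'a :: field_char_0 poly"
  assumes V: "finite V" and n: "n > 0" and Z: "card {z :: 'a. z ^ n = 1} = n"
    and M: "\<And>v s w z. v \<in> V \<Longrightarrow> w \<in> V \<Longrightarrow> s \<in> {0..<int n} \<Longrightarrow> z ^ n = 1 \<Longrightarrow>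
      (\<Sum>t\<in>{0..<int n}. M (v, s) (w, t) * [:z powi t:]) = [:z powi s:] * B z v w"
  shows "setdet (V \<times> {0..<int n}) M = (\<Prod>z | z ^ n = 1. setdet V (B z))"
proof -
  let ?S = "{0..<int n}" and ?Z = "{z :: 'a. z ^ n = 1}"
  have finZ: "finite ?Z" using Z n by (metis card.infinite less_irrefl)
  \<comment> \<open>Numbering the roots of unity by the residues makes the Fourier matrix square
    over the index set of \<open>M\<close>.\<close>
  then obtain g where g: "bij_betw g ?S ?Z"
    using Z finite_same_card_bij[of ?S ?Z] by auto
  have gn: "g k ^ n = 1" if "k \<in> ?S" for k using g that by (auto simp: bij_betw_def)
  have g0: "g k \<noteq> 0" if "k \<in> ?S" for k using gn[OF that] n by (auto simp: power_0_left)
  \<comment> \<open>\<open>F\<close> is the Fourier matrix, \<open>F'\<close> is its inverse up to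
    the factor \<open>n\<close>, and \<open>D\<close> is the block-diagonal form of
    \<open>M\<close>. The intertwining relation is \<open>M F = F D\<close>.\<close>
  define F where "F x y = (if fst x = fst y then [:g (snd y) powi snd x:] else 0)" for x y :: "'v \<times> int"
  define F' where "F' x y = (if fst x = fst y then [:g (snd x) powi (- snd y):] else 0)"
    for x y :: "'v \<times> int"
  define D where "D x y = (if snd x = snd y then B (g (snd x)) (fst x) (fst y) else 0)"
    for x y :: "'v \<times> int"
  have fin: "finite (V \<times> ?S)" using V by simp
  have sumF: "(\<Sum>y\<in>V \<times> ?S. A y * F y (u, k)) = (\<Sum>t\<in>?S. A (u, t) * [:g k powi t:])"
    if "u \<in> V" for A u k
  proof -
    have "(\<Sum>y\<in>V \<times> ?S. A y * F y (u, k)) = (\<Sum>w\<in>V. \<Sum>t\<in>?S. A (w, t) * F (w, t) (u, k))"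
      by (simp add: sum.cartesian_product)
    also have "\<dots> = (\<Sum>w\<in>V. if w = u then \<Sum>t\<in>?S. A (u, t) * [:g k powi t:] else 0)"
      by (intro sum.cong refl) (auto simp: F_def)
    finally show ?thesis using that V by simp
  qed
  have "(\<Sum>y\<in>V \<times> ?S. M x y * F y z) = (\<Sum>y\<in>V \<times> ?S. F x y * D y z)"
    if x: "x \<in> V \<times> ?S" and z: "z \<in> V \<times> ?S" for x z
  proof -
    obtain v s u k where xz: "x = (v, s)" "z = (u, k)" by (metis surj_pair)
    have *: "v \<in> V" "s \<in> ?S" "u \<in> V" "k \<in> ?S" using x z xz by auto
    have "(\<Sum>y\<in>V \<times> ?S. F x y * D y z) = (\<Sum>w\<in>V. \<Sum>t\<in>?S. F x (w, t) * D (w, t) z)"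
      by (simp add: sum.cartesian_product)
    also have "\<dots> = (\<Sum>w\<in>V. \<Sum>t\<in>?S. if t = k then
        (if w = v then [:g k powi s:] * B (g k) v u else 0) else 0)"
      by (intro sum.cong refl) (auto simp: F_def D_def xz)
    also have "\<dots> = [:g k powi s:] * B (g k) v u"
      using V * by (simp only: sum.delta finite_atLeastLessThan_int if_True)
    also have "\<dots> = (\<Sum>y\<in>V \<times> ?S. M x y * F y z)"
      using M[OF *(1) *(3) *(2) gn[OF *(4)]] sumF[OF *(3), of "M x" k] by (simp add: xz)
    finally show ?thesis by simp
  qed
  then have "setdet (V \<times> ?S) (\<lambda>x z. \<Sum>y\<in>V \<times> ?S. M x y * F y z) =
      setdet (V \<times> ?S) (\<lambda>x z. \<Sum>y\<in>V \<times> ?S. F x y * D y z)"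
    by (intro setdet_cong)
  then have eq: "setdet (V \<times> ?S) M * setdet (V \<times> ?S) F = setdet (V \<times> ?S) F * setdet (V \<times> ?S) D"
    by (simp only: setdet_mult[OF fin])
  have "(\<Sum>y\<in>V \<times> ?S. F' x y * F y z) = (if z = x then of_nat n else 0)"
    if x: "x \<in> V \<times> ?S" and z: "z \<in> V \<times> ?S" for x z
  proof -
    obtain v s u k where xz: "x = (v, s)" "z = (u, k)" by (metis surj_pair)
    have *: "v \<in> V" "s \<in> ?S" "u \<in> V" "k \<in> ?S" using x z xz by auto
    have "(\<Sum>y\<in>V \<times> ?S. F' x y * F y z) = (\<Sum>t\<in>?S. F' (v, s) (u, t) * [:g k powi t:])"
      using sumF[OF *(3), of "F' x" k] by (simp add: xz)
    also have "\<dots> = (\<Sum>t\<in>?S. if u = v then [:(g k / g s) powi t:] else 0)"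
      by (intro sum.cong refl)
        (auto simp: F'_def power_int_minus power_int_divide_distrib field_simps)
    also have "\<dots> = (if u = v then [:\<Sum>t\<in>?S. (g k / g s) powi t:] else 0)"
      by (auto simp: sum_to_poly)
    also have "(\<Sum>t\<in>?S. (g k / g s) powi t) = (\<Sum>i<n. (g k / g s) ^ i)"
      by (rule sum.reindex_bij_witness[where i = int and j = nat]) (auto simp: power_int_def)
    also have "\<dots> = (if g k / g s = 1 then of_nat n else 0)"
      using gn[OF *(2)] gn[OF *(4)] by (intro sum_powers_root_of_unity) (simp add: power_divide)
    also have "g k / g s = 1 \<longleftrightarrow> k = s"
      using g0[OF *(2)] g * by (auto simp: bij_betw_def inj_on_def)
    finally show ?thesis by (auto simp: xz of_nat_poly)
  qed
  then have "setdet (V \<times> ?S) (\<lambda>x z. \<Sum>y\<in>V \<times> ?S. F' x y * F y z) =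
      setdet (V \<times> ?S) (\<lambda>x z. if z = x then of_nat n else 0)"
    by (intro setdet_cong)
  then have "setdet (V \<times> ?S) F' * setdet (V \<times> ?S) F = of_nat n ^ card (V \<times> ?S)"
    by (simp only: setdet_mult[OF fin] setdet_scalar[OF fin])
  \<comment> \<open>\<open>F' F\<close> is the scalar \<open>n\<close>, which is nonzero in
    characteristic 0; hence \<open>det F\<close> can be cancelled.\<close>
  then have "setdet (V \<times> ?S) F \<noteq> 0" using n by auto
  then have "setdet (V \<times> ?S) M = setdet (V \<times> ?S) D" using eq by simp
  also have "\<dots> = (\<Prod>k\<in>?S. setdet V (B (g k)))"
    unfolding D_def using V by (intro setdet_blocks) auto
  also have "\<dots> = (\<Prod>z\<in>?Z. setdet V (B z))"
    by (rule prod.reindex_bij_betw[OF g])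
  finally show ?thesis .
qed

lemma voltage_assignment_mod:
  assumes "voltage_assignment X bar integer_group \<alpha>" "n > 0"
  shows "voltage_assignment X bar (integer_mod_group n) (\<lambda>e. \<alpha> e mod int n)"
  using assms
  by (auto simp: voltage_assignment_def carrier_integer_mod_group mod_minus_eq)

lemma twisted_laplacian_one:
  fixes X :: "('v, 'e) pre_digraph"
  shows "twisted_laplacian X \<alpha> 1 v w =
    (if v = w then of_nat (card (out_arcs X v)) else 0) - of_nat (card {e \<in> out_arcs X v. head X e = w})"
  by (simp add: twisted_laplacian_def)

text \<open>The rows of the untwisted Laplacian sum to 0, so the constant functions lie in its
  kernel.\<close>

lemma setdet_twisted_laplacian_one:
  fixes X :: "('v, 'e) pre_digraph"
  assumes graph: "wf_digraph X" "fin_digraph X" and ne: "verts X \<noteq> {}"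
  shows "setdet (verts X) (twisted_laplacian X \<alpha> (1 :: 'a :: field)) = 0"
proof -
  interpret wf_digraph X by fact
  interpret fin_digraph X by fact
  obtain v0 where "v0 \<in> verts X" using ne by blast
  moreover have "(\<Sum>w\<in>verts X. twisted_laplacian X \<alpha> (1 :: 'a) v w * 1) = 0"
    if v: "v \<in> verts X" for v
  proof -
    have "card (out_arcs X v) = card (\<Union>w\<in>verts X. {e \<in> out_arcs X v. head X e = w})"
      by (intro arg_cong[where f = card]) auto
    also have "\<dots> = (\<Sum>w\<in>verts X. card {e \<in> out_arcs X v. head X e = w})"
      by (intro card_UN_disjoint) auto
    finally show ?thesis
      using v by (simp add: twisted_laplacian_one sum_subtractf)
  qed
  ultimately show ?thesis
    by (intro setdet_eq_0_kernel[where u = "\<lambda>_. 1"]) auto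
qed

text \<open>Linear coefficients are compared in the Fourier factorisation of
  \<open>det (x + L)\<close> for the cover. The factor at \<open>z = 1\<close> has constant term 0,
  so its linear coefficient, which counts the trees of \<open>X\<close>, meets only the constant
  terms of the other factors. The cover has \<open>n * card (verts X)\<close> vertices, and
  \<open>card (verts X)\<close> cancels.\<close>

theorem num_spanning_trees_cyclic_cover:
  fixes X :: "('v, 'e) pre_digraph" and \<alpha> :: "'e \<Rightarrow> int" and n :: nat
  defines "G \<equiv> integer_mod_group n" and "\<beta> \<equiv> \<lambda>e. \<alpha> e mod int n"
  assumes graph: "bidirected_digraph X bar" "fin_digraph X" and ne: "verts X \<noteq> {}"
    and voltage: "voltage_assignment X bar integer_group \<alpha>"
    and n: "n > 0" and Z: "card {z :: 'a :: field_char_0. z ^ n = 1} = n"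
  shows "of_nat (n * num_spanning_trees (derived_graph X G \<beta>) (derived_bar X bar G \<beta>)) =
    of_nat (num_spanning_trees X bar) *
    (\<Prod>z | z ^ n = 1 \<and> z \<noteq> 1. setdet (verts X) (twisted_laplacian X \<alpha> (z :: 'a)))"
proof -
  interpret bidirected_digraph X bar by fact
  interpret fin_digraph X by fact
  let ?V = "verts X" and ?S = "{0..<int n}" and ?Z = "{z :: 'a. z ^ n = 1}"
  let ?Y = "derived_graph X G \<beta>" and ?barY = "derived_bar X bar G \<beta>"
  have carrier: "carrier G = ?S" using n by (simp add: G_def carrier_integer_mod_group)
  have graphY: "bidirected_digraph ?Y ?barY"
    unfolding G_def \<beta>_def
    by (intro bidirected_digraph_derived_graph graph voltage_assignment_mod voltage n) simp
  then interpret Y: bidirected_digraph ?Y ?barY .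
  have finY: "fin_digraph ?Y"
    by unfold_locales (auto simp: derived_graph_def carrier)
  define M :: "'v \<times> int \<Rightarrow> 'v \<times> int \<Rightarrow> 'a poly" where "M x y =
    (if x = y then [:0, 1:] + of_nat (card (out_arcs ?Y x)) else 0)
      - of_nat (card {e \<in> out_arcs ?Y x. head ?Y e = y})" for x y
  define B :: "'a \<Rightarrow> 'v \<Rightarrow> 'v \<Rightarrow> 'a poly" where "B z v w =
    (if v = w then [:0, 1:] else 0) + [:twisted_laplacian X \<alpha> z v w:]" for z v w
  have finZ: "finite ?Z" using Z n by (metis card.infinite less_irrefl)
  have vertsY: "verts ?Y = ?V \<times> ?S" by (simp add: derived_graph_def carrier)
  have out: "out_arcs ?Y (v, s) = (\<lambda>e. (e, s)) ` out_arcs X v" if "s \<in> ?S" for v s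
    using that by (auto simp: derived_graph_def carrier out_arcs_def)
  have card_out: "card (out_arcs ?Y (v, s)) = card (out_arcs X v)" if "s \<in> ?S" for v s
    by (simp add: out[OF that] card_image inj_on_def)
  have card_head: "card {e \<in> out_arcs ?Y (v, s). head ?Y e = (w, t)} =
      card {e \<in> out_arcs X v. head X e = w \<and> (s + \<alpha> e) mod int n = t}" if "s \<in> ?S" for v s w t
  proof -
    have "{e \<in> out_arcs ?Y (v, s). head ?Y e = (w, t)} =
        (\<lambda>e. (e, s)) ` {e \<in> out_arcs X v. head X e = w \<and> (s + \<alpha> e) mod int n = t}"
      unfolding out[OF that] by (auto simp: derived_graph_def G_def \<beta>_def mod_add_right_eq)
    then show ?thesis by (simp add: card_image inj_on_def)
  qed
  have "setdet (?V \<times> ?S) M = (\<Prod>z\<in>?Z. setdet ?V (B z))"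
  proof (rule setdet_block_circulant[OF finite_verts n Z])
    fix v w s and z :: 'a
    assume v: "v \<in> ?V" and w: "w \<in> ?V" and s: "s \<in> ?S" and z: "z ^ n = 1"
    have z0: "z \<noteq> 0" using z n by (auto simp: power_0_left)
    let ?E = "{e \<in> out_arcs X v. head X e = w}"
    have Bz: "B z v w = (if v = w then [:0, 1:] + of_nat (card (out_arcs X v)) else 0)
        - [:\<Sum>e\<in>?E. z powi \<alpha> e:]"
      by (simp add: B_def twisted_laplacian_def of_nat_poly)
    have Mval: "M (v, s) (w, t) =
        (if v = w \<and> s = t then [:0, 1:] + of_nat (card (out_arcs X v)) else 0)
        - of_nat (card {e \<in> out_arcs X v. head X e = w \<and> (s + \<alpha> e) mod int n = t})" for t
      by (simp only: M_def card_out[OF s] card_head[OF s] prod.inject)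
    have "(\<Sum>t\<in>?S. M (v, s) (w, t) * [:z powi t:]) =
        (\<Sum>t\<in>?S. if s = t then if v = w
            then ([:0, 1:] + of_nat (card (out_arcs X v))) * [:z powi s:] else 0 else 0)
        - (\<Sum>t\<in>?S. of_nat (card {e \<in> ?E. (s + \<alpha> e) mod int n = t}) * [:z powi t:])"
      unfolding sum_subtractf[symmetric]
      by (intro sum.cong refl)
        (auto simp: Mval left_diff_distrib smult_diff_right conj_assoc)
    also have "(\<Sum>t\<in>?S. if s = t then if v = w
            then ([:0, 1:] + of_nat (card (out_arcs X v))) * [:z powi s:] else 0 else 0)
        = (if v = w then ([:0, 1:] + of_nat (card (out_arcs X v))) * [:z powi s:] else 0)"
      using s by (simp only: sum.delta' finite_atLeastLessThan_int if_True)
    \<comment> \<open>The edges are regrouped by the sheet \<open>t\<close> in which they end; as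
      \<open>z ^ n = 1\<close>, reducing the exponent modulo \<open>n\<close> does not change the
      power of \<open>z\<close>.\<close>
    also have "(\<Sum>t\<in>?S. of_nat (card {e \<in> ?E. (s + \<alpha> e) mod int n = t}) * [:z powi t:]) =
        (\<Sum>t\<in>?S. \<Sum>e\<in>{e \<in> ?E. (s + \<alpha> e) mod int n = t}. [:z powi (s + \<alpha> e):])"
    proof (intro sum.cong refl)
      fix t
      have "(\<Sum>e\<in>{e \<in> ?E. (s + \<alpha> e) mod int n = t}. [:z powi (s + \<alpha> e):]) =
          (\<Sum>e\<in>{e \<in> ?E. (s + \<alpha> e) mod int n = t}. [:z powi t:])"
        by (intro sum.cong refl) (auto simp: power_int_mod_root_of_unity[OF z n])
      then show "of_nat (card {e \<in> ?E. (s + \<alpha> e) mod int n = t}) * [:z powi t:] =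
          (\<Sum>e\<in>{e \<in> ?E. (s + \<alpha> e) mod int n = t}. [:z powi (s + \<alpha> e):])" by simp
    qed
    also have "\<dots> = (\<Sum>e\<in>?E. [:z powi (s + \<alpha> e):])"
      using n by (intro sum.group) auto
    also have "\<dots> = [:z powi s:] * [:\<Sum>e\<in>?E. z powi \<alpha> e:]"
      using z0 by (simp add: power_int_add sum_to_poly[symmetric] sum_distrib_left mult.commute)
    finally show "(\<Sum>t\<in>?S. M (v, s) (w, t) * [:z powi t:]) = [:z powi s:] * B z v w"
      unfolding Bz by (cases "v = w")
        (simp_all only: right_diff_distrib if_True if_False mult_zero_left mult_zero_right mult.commute simp_thms)
  qed
  then have "(of_nat (card (verts ?Y) * num_spanning_trees ?Y ?barY) :: 'a) =
      poly.coeff (\<Prod>z\<in>?Z. setdet ?V (B z)) 1"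
    using matrix_tree[OF graphY finY, where ?'b = 'a] unfolding M_def[symmetric] vertsY by simp
  also have "(\<Prod>z\<in>?Z. setdet ?V (B z)) = setdet ?V (B 1) * (\<Prod>z\<in>?Z - {1}. setdet ?V (B z))"
    using finZ by (intro prod.remove) auto
  also have "?Z - {1} = {z. z ^ n = 1 \<and> z \<noteq> 1}" by auto
  also have "poly.coeff (setdet ?V (B 1) * (\<Prod>z | z ^ n = 1 \<and> z \<noteq> 1. setdet ?V (B z))) 1 =
      poly.coeff (setdet ?V (B 1)) 0 * poly.coeff (\<Prod>z | z ^ n = 1 \<and> z \<noteq> 1. setdet ?V (B z)) 1
      + poly.coeff (setdet ?V (B 1)) 1 * poly.coeff (\<Prod>z | z ^ n = 1 \<and> z \<noteq> 1. setdet ?V (B z)) 0"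
    by (simp add: coeff_mult)
  also have B0: "poly.coeff (setdet ?V (B z)) 0 = setdet ?V (twisted_laplacian X \<alpha> z)" for z
    unfolding coeff_setdet_0 by (intro setdet_cong) (simp add: B_def)
  also have "setdet ?V (twisted_laplacian X \<alpha> (1 :: 'a)) = 0"
    by (intro setdet_twisted_laplacian_one ne) (unfold_locales)
  also have "poly.coeff (setdet ?V (B 1)) 1 = of_nat (card ?V * num_spanning_trees X bar)"
  proof -
    have "B 1 = (\<lambda>v w. (if v = w then [:0, 1:] + of_nat (card (out_arcs X v)) else 0)
      - of_nat (card {e \<in> out_arcs X v. head X e = w}))"
      by (intro ext) (simp add: B_def twisted_laplacian_one of_nat_poly)
    then show ?thesis by (simp only: matrix_tree[OF graph])
  qed
  also have "poly.coeff (\<Prod>z | z ^ n = 1 \<and> z \<noteq> 1. setdet ?V (B z)) 0 =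
      (\<Prod>z | z ^ n = 1 \<and> z \<noteq> 1. setdet ?V (twisted_laplacian X \<alpha> z))"
    by (simp add: poly_0_coeff_0[symmetric] poly_prod) (simp add: poly_0_coeff_0 B0)
  finally have "of_nat (card ?V) * of_nat (n * num_spanning_trees ?Y ?barY) =
      of_nat (card ?V) * (of_nat (num_spanning_trees X bar) *
      (\<Prod>z | z ^ n = 1 \<and> z \<noteq> 1. setdet ?V (twisted_laplacian X \<alpha> (z :: 'a))))"
    by (simp add: vertsY card_cartesian_product mult_ac)
  then show ?thesis using ne by (simp add: card_eq_0_iff)
qed


section \<open>Splitting of integer polynomials\<close>

interpretation rat_vs: vector_space "\<lambda>(q :: rat) (x :: 'a :: field_char_0). of_rat q * x"
  by unfold_locales (simp_all add: algebra_simps of_rat_add of_rat_mult)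

text \<open>Algebraicity over \<open>\<rat>\<close>, in the form that is evidently preserved by ring operations:
  \<open>x\<close> acts on a nonzero finitely generated space.\<close>

definition rat_alg :: "'a :: field_char_0 \<Rightarrow> bool" where
  "rat_alg x \<longleftrightarrow> (\<exists>T. finite T \<and> (\<exists>t\<in>T. t \<noteq> 0) \<and> (\<forall>t\<in>T. x * t \<in> rat_vs.span T))"

lemma rat_span_mult:
  assumes "s \<in> rat_vs.span S" "t \<in> rat_vs.span T"
  shows "s * t \<in> rat_vs.span ((\<lambda>(a, b). a * b) ` (S \<times> T))"
proof -
  let ?W = "rat_vs.span ((\<lambda>(a, b). a * b) ` (S \<times> T))"
  have *: "s * b \<in> ?W" if "b \<in> T" for b
    using assms(1)
  proof (induction rule: rat_vs.span_induct_alt)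
    case (step c x y)
    have "x * b \<in> ?W" using step that by (intro rat_vs.span_base) auto
    then have "of_rat c * (x * b) + y * b \<in> ?W"
      using step by (intro rat_vs.span_add rat_vs.span_scale)
    then show ?case by (simp add: algebra_simps)
  qed (simp add: rat_vs.span_zero)
  show ?thesis using assms(2)
  proof (induction rule: rat_vs.span_induct_alt)
    case (step c x y)
    have "of_rat c * (s * x) + s * y \<in> ?W"
      using step * by (intro rat_vs.span_add rat_vs.span_scale)
    then show ?case by (simp add: algebra_simps)
  qed (simp add: rat_vs.span_zero)
qed

text \<open>The products of the generators serve for both: \<open>x\<close> acts on the first factor
  and \<open>y\<close> on the second.\<close>

lemma rat_alg_add_mult:
  assumes "rat_alg x" "rat_alg y"
  shows "rat_alg (x + y) \<and> rat_alg (x * y)"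
proof -
  obtain S s0 where S: "finite S" "s0 \<in> S" "s0 \<noteq> 0" "\<And>s. s \<in> S \<Longrightarrow> x * s \<in> rat_vs.span S"
    using assms(1) by (auto simp: rat_alg_def)
  obtain T t0 where T: "finite T" "t0 \<in> T" "t0 \<noteq> 0" "\<And>t. t \<in> T \<Longrightarrow> y * t \<in> rat_vs.span T"
    using assms(2) by (auto simp: rat_alg_def)
  let ?ST = "(\<lambda>(a, b). a * b) ` (S \<times> T)"
  have fin: "finite ?ST" and nz: "s0 * t0 \<in> ?ST" "s0 * t0 \<noteq> 0" using S T by auto
  have add: "(x + y) * (s * t) \<in> rat_vs.span ?ST" and mult: "(x * y) * (s * t) \<in> rat_vs.span ?ST"
    if st: "s \<in> S" "t \<in> T" for s t
  proof -
    have "(x * s) * t + s * (y * t) \<in> rat_vs.span ?ST"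
      using st S(4) T(4) by (intro rat_vs.span_add rat_span_mult) (auto intro: rat_vs.span_base)
    then show "(x + y) * (s * t) \<in> rat_vs.span ?ST" by (simp add: algebra_simps)
    have "(x * s) * (y * t) \<in> rat_vs.span ?ST"
      using st S(4) T(4) by (intro rat_span_mult)
    then show "(x * y) * (s * t) \<in> rat_vs.span ?ST" by (simp add: mult_ac)
  qed
  have ne: "\<exists>t\<in>?ST. t \<noteq> 0" using nz by blast
  show ?thesis
    unfolding rat_alg_def using fin ne add mult
    by (intro conjI exI[of _ ?ST]) (auto simp del: mult_eq_0_iff)
qed

lemma rat_alg_of_int: "rat_alg (of_int k)"
  unfolding rat_alg_def
  using rat_vs.span_scale[OF rat_vs.span_base[of "1 :: 'a" "{1}"], of "of_int k"]
  by (intro exI[of _ "{1}"]) simp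

text \<open>The powers of \<open>x\<close> below the degree span a suitable space: the equation,
  divided by the leading coefficient, expresses the next power through them.\<close>

lemma rat_alg_root:
  fixes f :: "int poly"
  assumes "f \<noteq> 0" and root: "poly (map_poly of_int f) x = 0"
  shows "rat_alg x"
proof -
  let ?d = "Polynomial.degree f" and ?a = "lead_coeff f"
  let ?T = "(\<lambda>i. x ^ i) ` {..<?d}"
  have sum: "(\<Sum>i\<le>?d. of_int (poly.coeff f i) * x ^ i) = 0"
    using root by (simp add: poly_altdef degree_map_poly)
  \<comment> \<open>A nonzero constant has no root. This puts \<open>x ^ 0 = 1\<close> among the
    generators, which provides a nonzero one.\<close>
  have "?d \<noteq> 0"
  proof
    assume "?d = 0"
    then obtain c where "f = [:c:]" using degree_eq_zeroE by blast
    then show False using root \<open>f \<noteq> 0\<close> by (simp add: map_poly_pCons)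
  qed
  have "of_int ?a * x ^ ?d + (\<Sum>i<?d. of_int (poly.coeff f i) * x ^ i) = 0"
    using sum by (simp add: lessThan_Suc_atMost[symmetric] add.commute)
  moreover have a: "of_int ?a \<noteq> (0 :: 'a)" using \<open>f \<noteq> 0\<close> by simp
  ultimately have "x ^ ?d = (- 1 / of_int ?a) * (\<Sum>i<?d. of_int (poly.coeff f i) * x ^ i)"
    by (simp add: field_simps eq_neg_iff_add_eq_0)
  also have "\<dots> = of_rat (- 1 / of_int ?a) * (\<Sum>i<?d. of_rat (of_int (poly.coeff f i)) * x ^ i)"
    by (simp add: of_rat_divide of_rat_minus)
  also have "\<dots> \<in> rat_vs.span ?T"
    by (intro rat_vs.span_scale rat_vs.span_sum rat_vs.span_base) auto
  finally have top: "x ^ ?d \<in> rat_vs.span ?T" .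
  have "x * x ^ i \<in> rat_vs.span ?T" if "i < ?d" for i
  proof (cases "Suc i = ?d")
    case False
    then have "x ^ Suc i \<in> ?T" using that by (intro imageI) auto
    then show ?thesis by (auto intro: rat_vs.span_base)
  qed (use top in \<open>metis power_Suc\<close>)
  moreover have "1 \<in> ?T" using \<open>?d \<noteq> 0\<close> by (intro image_eqI[of _ _ 0]) auto
  ultimately show ?thesis
    unfolding rat_alg_def by (intro exI[of _ ?T]) (auto intro!: bexI[of _ "1 :: 'a"])
qed

text \<open>Multiplication by \<open>x\<close> on the generators is described by a rational matrix,
  and the vector of the generators is an eigenvector for \<open>x\<close>. So \<open>x\<close> is a
  root of the characteristic polynomial.\<close>

lemma rat_alg_imp_algebraic_over_Rats:
  fixes x :: "'a :: field_char_0"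
  assumes "rat_alg x"
  shows "x \<in> algebraic_over \<rat>"
proof -
  obtain T t0 where T: "finite T" "t0 \<in> T" "t0 \<noteq> 0" "\<And>t. t \<in> T \<Longrightarrow> x * t \<in> rat_vs.span T"
    using assms by (auto simp: rat_alg_def)
  have "\<exists>u. x * t = (\<Sum>s\<in>T. of_rat (u s) * s)" if "t \<in> T" for t
    using T(4)[OF that] unfolding rat_vs.span_finite[OF T(1)] by auto
  then obtain u where u: "\<And>t. t \<in> T \<Longrightarrow> x * t = (\<Sum>s\<in>T. of_rat (u t s) * s)" by metis
  obtain g n where g: "bij_betw g {0..<n :: nat} T"
    using ex_bij_betw_nat_finite[OF T(1)] by blast
  define A where "A = mat n n (\<lambda>(i, j). u (g i) (g j))"
  have A: "A \<in> carrier_mat n n" by (simp add: A_def)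
  let ?B = "map_mat of_rat A :: 'a mat"
  have B: "?B \<in> carrier_mat n n" by (simp add: A_def)
  have hom: "comm_ring_hom (of_rat :: rat \<Rightarrow> 'a)"
    by unfold_locales (simp_all add: of_rat_add of_rat_mult)
  let ?v = "Matrix.vec n g"
  obtain k where k: "k < n" "g k = t0" using g T(2) by (auto simp: bij_betw_def)
  have "?v $ k \<noteq> 0\<^sub>v n $ k" using k T(3) by simp
  then have "?v \<noteq> 0\<^sub>v n" by metis
  moreover have "?B *\<^sub>v ?v = x \<cdot>\<^sub>v ?v"
  proof (intro eq_vecI)
    fix i assume "i < dim_vec (x \<cdot>\<^sub>v ?v)"
    then have i: "i < n" by simp
    then have "g i \<in> T" using g by (auto simp: bij_betw_def)
    from u[OF this] have "x * g i = (\<Sum>j = 0..<n. of_rat (u (g i) (g j)) * g j)"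
      by (simp add: sum.reindex_bij_betw[OF g, symmetric])
    then show "(?B *\<^sub>v ?v) $ i = (x \<cdot>\<^sub>v ?v) $ i" using i by (simp add: scalar_prod_def A_def)
  qed (simp add: A_def)
  ultimately have "eigenvalue ?B x"
    by (auto simp: eigenvalue_def eigenvector_def A_def intro!: exI[of _ ?v])
  then have "poly (char_poly ?B) x = 0" using eigenvalue_root_char_poly[OF B] by blast
  moreover have "char_poly ?B = map_poly of_rat (char_poly A)" by (rule comm_ring_hom.char_poly_hom[OF hom A])
  moreover have "char_poly ?B \<noteq> 0" using degree_monic_char_poly[OF B] by auto
  ultimately show ?thesis
    unfolding algebraic_over_def by (auto intro!: exI[of _ "map_poly of_rat (char_poly A)"] simp: coeff_map_poly)
qed

lemma rat_alg_poly:
  assumes "\<And>i. rat_alg (poly.coeff q i)" "rat_alg x"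
  shows "rat_alg (poly q x)"
  using assms(1)
proof (induction q)
  case 0
  show ?case using rat_alg_of_int[of 0] by simp
next
  case (pCons a q)
  have "rat_alg (poly.coeff q i)" for i using pCons.prems[of "Suc i"] by simp
  moreover have "rat_alg a" using pCons.prems[of 0] by simp
  ultimately show ?case using pCons.IH assms(2) by (simp add: rat_alg_add_mult)
qed

text \<open>The coefficients of the quotient by \<open>[:- x, 1:]\<close> are values at
  \<open>x\<close> of the tails of \<open>q\<close>, as in Horner's scheme.\<close>

lemma rat_alg_synthetic_div:
  assumes "\<And>i. rat_alg (poly.coeff q i)" "rat_alg x"
  shows "rat_alg (poly.coeff (synthetic_div q x) i)"
  using assms(1)
proof (induction q arbitrary: i)
  case 0
  show ?case using rat_alg_of_int[of 0] by simp
next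
  case (pCons a q)
  have q: "rat_alg (poly.coeff q i)" for i using pCons.prems[of "Suc i"] by simp
  show ?case
    using pCons.IH[OF q] rat_alg_poly[OF q assms(2)] by (cases i) auto
qed

section \<open>Products of monic linear factors\<close>

lemma lead_coeff_prod_linear: "lead_coeff (\<Prod>x\<in>#A. [:- x, 1 :: 'a :: idom:]) = 1"
  by (induction A) (simp_all only: lead_coeff_mult image_mset_add_mset prod_mset.add_mset
      image_mset_empty prod_mset_empty lead_coeff_1, simp)

lemma prod_linear_neq_0: "(\<Prod>x\<in>#A. [:- x, 1 :: 'a :: idom:]) \<noteq> 0"
  using lead_coeff_prod_linear[of A] by (metis lead_coeff_1 leading_coeff_0_iff one_neq_zero)

lemma proots_prod_linear: "proots (\<Prod>x\<in>#A. [:- x, 1 :: 'a :: idom:]) = A"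
proof (induction A)
  case (add x A)
  have "proots ([:- x, 1:] * (\<Prod>x\<in>#A. [:- x, 1:])) = {#x#} + proots (\<Prod>x\<in>#A. [:- x, 1:])"
    using prod_linear_neq_0[of A] by (subst proots_mult) auto
  then show ?case using add by (simp del: mult_pCons_left)
qed simp

lemma degree_prod_linear: "Polynomial.degree (\<Prod>x\<in>#A. [:- x, 1 :: 'a :: idom:]) = size A"
proof (induction A)
  case (add x A)
  then show ?case using prod_linear_neq_0[of A] by (simp add: degree_mult_eq del: mult_pCons_left)
qed simp

section \<open>The absolute value, and splitting over its field\<close>

context padic_complex
begin

lemma av_1: "av 1 = 1"
  using av_mult[of 1 1] av_eq_0_iff[of 1] by simp

lemma av_power: "av (x ^ k) = av x ^ k"
  by (induction k) (simp_all add: av_1 av_mult)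

lemma av_minus: "av (- x) = av x"
proof -
  have "av (- 1) ^ 2 = 1" using av_mult[of "- 1" "- 1"] av_1 by (simp add: power2_eq_square)
  then have "av (- 1) = 1" using av_nonneg[of "- 1"] by (simp add: power2_eq_1_iff)
  then show ?thesis using av_mult[of "- 1" x] by simp
qed

lemma av_diff_commute: "av (x - y) = av (y - x)"
  using av_minus[of "x - y"] by simp

lemma av_prod: "av (\<Prod>x\<in>A. f x) = (\<Prod>x\<in>A. av (f x))"
  by (induction A rule: infinite_finite_induct) (simp_all add: av_1 av_mult)

lemma av_prod_mset: "av (\<Prod>x\<in>#A. f x) = (\<Prod>x\<in>#A. av (f x))"
  by (induction A) (simp_all add: av_1 av_mult)

text \<open>Write \<open>y\<close> as \<open>(x + y) - x\<close>: since \<open>x\<close> is too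
  small to account for \<open>av y\<close>, the sum \<open>x + y\<close> must.\<close>

lemma av_add_eq_max:
  assumes "av x < av y"
  shows "av (x + y) = av y"
proof (rule antisym)
  show "av (x + y) \<le> av y" using av_add[of x y] assms by simp
  have "av y \<le> max (av (x + y)) (av (- x))" using av_add[of "x + y" "- x"] by simp
  then show "av y \<le> av (x + y)" using assms by (simp add: av_minus)
qed

lemma Rats_subset_av_closure: "\<rat> \<subseteq> av_closure av \<rat>"
proof -
  interpret Metric_space UNIV "\<lambda>x y. av (x - y)"
  proof
    fix x y z :: 'a
    have "av (x - z) \<le> max (av (x - y)) (av (y - z))" using av_add[of "x - y" "y - z"] by simp
    then show "av (x - z) \<le> av (x - y) + av (y - z)"
      using av_nonneg[of "x - y"] av_nonneg[of "y - z"] by linarith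
  qed (auto simp: av_nonneg av_eq_0_iff av_diff_commute)
  show ?thesis unfolding av_closure_def by (intro closure_of_subset) simp
qed

text \<open>Makes \<open>alg_closed\<close>, which concerns the closure of the rationals, applicable
  to coefficients algebraic over the rationals.\<close>

lemma algebraic_over_closure: "algebraic_over \<rat> \<subseteq> algebraic_over (av_closure av \<rat>)"
proof
  fix x :: 'a assume "x \<in> algebraic_over \<rat>"
  then obtain f where "f \<noteq> 0" "\<And>i. poly.coeff f i \<in> \<rat>" "poly f x = 0"
    unfolding algebraic_over_def by blast
  then show "x \<in> algebraic_over (av_closure av \<rat>)"
    unfolding algebraic_over_def using Rats_subset_av_closure by blast
qed

text \<open>The coefficients of the cofactor of a partial factorisation are algebraic over the rationals,
  so that \<open>alg_closed\<close> yields a further root.\<close>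

lemma int_poly_splits:
  fixes f :: "int poly"
  assumes "f \<noteq> 0"
  shows "map_poly of_int f =
    Polynomial.smult (of_int (lead_coeff f)) (\<Prod>x\<in>#proots (map_poly of_int f :: 'a poly). [:- x, 1:])"
proof -
  let ?f = "map_poly of_int f :: 'a poly"
  have deg: "Polynomial.degree ?f = Polynomial.degree f" by (rule degree_map_poly) simp
  have nz: "?f \<noteq> 0" using assms deg by (metis coeff_map_poly leading_coeff_0_iff of_int_0 of_int_eq_0_iff)
  \<comment> \<open>Induction on the number \<open>k\<close> of linear factors split off; when
    \<open>k\<close> reaches the degree, the cofactor is a constant.\<close>
  have "\<exists>A g. ?f = (\<Prod>x\<in>#A. [:- x, 1:]) * g \<and> size A = k \<and> (\<forall>i. rat_alg (poly.coeff g i))"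
    if "k \<le> Polynomial.degree f" for k
    using that
  proof (induction k)
    case 0
    show ?case by (intro exI[of _ "{#}"] exI[of _ ?f]) (simp add: coeff_map_poly rat_alg_of_int)
  next
    case (Suc k)
    then obtain A g where A: "?f = (\<Prod>x\<in>#A. [:- x, 1:]) * g" "size A = k"
      and g: "\<And>i. rat_alg (poly.coeff g i)" by auto
    have "g \<noteq> 0" "(\<Prod>x\<in>#A. [:- x, 1:]) \<noteq> 0" using nz A(1) by auto
    then have "Polynomial.degree ?f = size A + Polynomial.degree g"
      unfolding A(1) by (simp add: degree_mult_eq degree_prod_linear)
    then have "Polynomial.degree g > 0" using Suc.prems A(2) deg by simp
    then obtain x where x: "poly g x = 0"
      using alg_closed[of g] g rat_alg_imp_algebraic_over_Rats algebraic_over_closure by blast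
    then have "poly ?f x = 0" by (simp add: A(1))
    \<comment> \<open>As a root of \<open>f\<close> itself, \<open>x\<close> is algebraic over the
      rationals, and the invariant passes to the next cofactor.\<close>
    then have alg: "rat_alg x" by (rule rat_alg_root[OF assms])
    have g_eq: "g = [:- x, 1:] * synthetic_div g x" using synthetic_div_correct'[of x g] x by simp
    have "?f = (\<Prod>x\<in>#A. [:- x, 1:]) * ([:- x, 1:] * synthetic_div g x)"
      by (subst g_eq[symmetric]) (rule A(1))
    then have "?f = (\<Prod>x\<in>#add_mset x A. [:- x, 1:]) * synthetic_div g x"
      by (simp only: image_mset_add_mset prod_mset.add_mset mult_ac)
    then show ?case
      using A(2) rat_alg_synthetic_div[OF g alg] by (intro exI[of _ "add_mset x A"]) auto
  qed
  from this[of "Polynomial.degree f"] obtain A g where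
    A: "?f = (\<Prod>x\<in>#A. [:- x, 1:]) * g" "size A = Polynomial.degree f" by auto
  have g: "g \<noteq> 0" and P: "(\<Prod>x\<in>#A. [:- x, 1:]) \<noteq> 0" using nz A(1) by auto
  then have "Polynomial.degree ?f = size A + Polynomial.degree g"
    unfolding A(1) by (simp add: degree_mult_eq degree_prod_linear)
  then have "Polynomial.degree g = 0" using A(2) deg by simp
  then obtain c where c: "g = [:c:]" using degree_eq_zeroE by blast
  have "proots ?f = A"
    unfolding A(1) using g P by (subst proots_mult) (auto simp: c proots_prod_linear)
  moreover have "of_int (lead_coeff f) = c"
    using arg_cong[OF A(1), of lead_coeff] deg by (simp add: lead_coeff_mult lead_coeff_prod_linear c coeff_map_poly)
  ultimately show ?thesis using A(1) by (simp add: c)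
qed

end


section \<open>Evaluation of the absolute values\<close>

text \<open>The derivative of \<open>t ^ n - 1\<close> vanishes at most at 0, which is not a root;
  so all roots are simple, and the splitting of integer polynomials applies.\<close>

lemma (in padic_complex) prod_roots_of_unity:
  assumes "n > 0"
  shows "[:0, 1:] ^ n - 1 = (\<Prod>z | z ^ n = 1. [:- z, 1 :: 'a:])"
proof -
  let ?F = "[:0, 1:] ^ n - 1 :: 'a poly" and ?f = "[:0, 1:] ^ n - 1 :: int poly"
  let ?Z = "{z :: 'a. z ^ n = 1}"
  have map: "map_poly of_int ?f = ?F" by (simp add: hom_distribs)
  have eval: "poly ?F z = z ^ n - 1" for z by simp
  have nz: "?F \<noteq> 0" using eval[of 0] assms by (metis diff_zero poly_0 power_0_left
      neq0_conv diff_0 neg_equal_0_iff_equal zero_neq_one)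
  have "rsquarefree ?F"
    unfolding rsquarefree_roots
  proof (intro allI notI)
    fix a assume a: "poly ?F a = 0 \<and> poly (pderiv ?F) a = 0"
    have "pderiv ?F = Polynomial.smult (of_nat n) ([:0, 1:] ^ (n - 1))"
      by (simp add: pderiv_diff pderiv_power pderiv_pCons)
    then have "a = 0" using a assms by simp
    then show False using a assms by (simp add: power_0_left)
  qed
  then have count: "count (proots ?F) z = count (mset_set ?Z) z" for z
    using nz poly_roots_finite[OF nz] rsquarefree_root_order[of ?F z]
    by (cases "z ^ n = 1") (auto simp: order_root intro: order_0I)
  then have "proots ?F = mset_set ?Z" by (intro multiset_eqI)
  moreover have "?f \<noteq> 0" using nz map by auto
  moreover have lead: "lead_coeff ?f = 1"
  proof -
    have "lead_coeff (- 1 + [:0, 1:] ^ n :: int poly) = lead_coeff ([:0, 1:] ^ n :: int poly)"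
      using assms by (intro lead_coeff_add_le) (simp add: degree_power_eq)
    then show ?thesis by (simp add: lead_coeff_power)
  qed
  ultimately show ?thesis
    using int_poly_splits[of ?f] unfolding map lead by (simp add: prod_unfold_prod_mset)
qed

lemma (in padic_complex) card_roots_of_unity:
  assumes "n > 0"
  shows "card {z :: 'a. z ^ n = 1} = n"
proof -
  have "Polynomial.degree (- 1 + [:0, 1:] ^ n :: 'a poly) = n"
    using assms by (subst degree_add_eq_right) (simp_all add: degree_power_eq)
  then have "Polynomial.degree (\<Prod>z | z ^ n = 1. [:- z, 1 :: 'a:]) = n"
    using prod_roots_of_unity[OF assms] by simp
  then show ?thesis by (simp add: degree_prod_eq_sum_degree)
qed

lemma (in padic_complex) prod_diff_roots_of_unity:
  assumes "n > 0"
  shows "(\<Prod>z | z ^ n = 1. a - z) = a ^ n - (1 :: 'a)"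
  using arg_cong[OF prod_roots_of_unity[OF assms], of "\<lambda>q. poly q a"] by (simp add: poly_prod)

lemma (in padic_complex) finite_roots_of_unity: "n > 0 \<Longrightarrow> finite {z :: 'a. z ^ n = 1}"
  using card_roots_of_unity by (metis card.infinite less_irrefl)

text \<open>Cancel \<open>t - 1\<close> in two factorisations of \<open>t ^ n - 1\<close>, one of
  them with the geometric sum, and evaluate at 1.\<close>

lemma (in padic_complex) prod_nontrivial_roots_of_unity:
  assumes "n > 0"
  shows "(\<Prod>z | z ^ n = 1 \<and> z \<noteq> 1. 1 - z) = (of_nat n :: 'a)"
proof -
  let ?P = "\<Prod>z | z ^ n = 1 \<and> z \<noteq> 1. [:- z, 1 :: 'a:]" and ?X = "[:0, 1:] :: 'a poly"
  have "{z :: 'a. z ^ n = 1} = insert 1 {z. z ^ n = 1 \<and> z \<noteq> 1}" by auto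
  moreover have "finite {z :: 'a. z ^ n = 1 \<and> z \<noteq> 1}"
    using finite_roots_of_unity[OF assms] by (rule rev_finite_subset) auto
  ultimately have "(\<Prod>z | z ^ n = 1. [:- z, 1 :: 'a:]) = [:- 1, 1:] * ?P"
    by (simp only: prod.insert) simp
  then have eq: "(?X - 1) * (\<Sum>i<n. ?X ^ i) = [:- 1, 1:] * ?P"
    by (simp only: power_diff_1_eq[symmetric] prod_roots_of_unity[OF assms])
  have linear: "?X - 1 = [:- 1, 1:]" by (simp add: one_pCons)
  have nz: "[:- 1, 1:] \<noteq> (0 :: 'a poly)" by simp
  have "(\<Sum>i<n. ?X ^ i) = ?P"
    using eq unfolding linear by (rule iffD1[OF mult_left_cancel[OF nz]])
  from arg_cong[OF this, of "\<lambda>q. poly q 1"] show ?thesis by (simp add: poly_prod poly_sum)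
qed

lemma (in padic_complex) av_root_of_unity:
  assumes "z ^ n = 1" "n > 0"
  shows "av z = 1"
proof -
  have "av z ^ n = 1" using av_power[of z n] assms(1) av_1 by simp
  then show ?thesis using assms(2) av_nonneg[of z] power_eq_1_iff by fastforce
qed

text \<open>Both sides are double products over the roots \<open>a\<close> of \<open>f\<close> and
  the roots of unity \<open>z\<close>. For fixed \<open>a\<close> the factors \<open>a - z\<close>
  multiply to \<open>a ^ n - 1\<close>, and \<open>av\<close> absorbs the signs.\<close>

lemma (in padic_complex) av_pierce_lehmer:
  fixes f :: "int poly"
  assumes "f \<noteq> 0" "n > 0"
  shows "av (pierce_lehmer n f) = (\<Prod>z | z ^ n = 1. av (poly (map_poly of_int f) z))"
proof -
  let ?R = "proots (map_poly of_int f :: 'a poly)" and ?Z = "{z :: 'a. z ^ n = 1}"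
  have eval: "av (poly (map_poly of_int f) z) = av (of_int (lead_coeff f)) * (\<Prod>a\<in>#?R. av (a - z))"
    for z
  proof -
    have "poly (\<Prod>a\<in>#A. [:- a, 1:]) z = (\<Prod>a\<in>#A. z - a)" for A :: "'a multiset"
      by (induction A) (simp_all add: algebra_simps)
    then show ?thesis
      by (subst int_poly_splits[OF assms(1)])
        (simp add: av_mult av_prod_mset av_diff_commute[of z])
  qed
  have swap: "(\<Prod>z\<in>?Z. \<Prod>a\<in>#A. av (a - z)) = (\<Prod>a\<in>#A. av (a ^ n - 1))" for A :: "'a multiset"
  proof (induction A)
    case (add a A)
    have "(\<Prod>z\<in>?Z. av (a - z)) = av (a ^ n - 1)"
      by (simp add: prod_diff_roots_of_unity[OF assms(2), symmetric] av_prod)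
    then show ?case using add by (simp add: prod.distrib)
  qed simp
  show ?thesis
    unfolding pierce_lehmer_def eval prod.distrib swap
    by (simp add: av_mult av_power av_prod_mset card_roots_of_unity[OF assms(2)])
qed

lemma (in padic_complex) av_pierce_lehmer_eq_mahler:
  fixes f :: "int poly"
  assumes "f \<noteq> 0" and no_root: "\<And>x :: 'a. av x = 1 \<Longrightarrow> poly (map_poly of_int f) x \<noteq> 0"
    and n: "n > 0"
  shows "av (pierce_lehmer n f) = mahler av f ^ n"
proof -
  let ?R = "proots (map_poly of_int f :: 'a poly)"
  have nz: "map_poly of_int f \<noteq> (0 :: 'a poly)" using no_root[OF av_1] by auto
  \<comment> \<open>Off the unit circle \<open>a ^ n\<close> and 1 have different absolute values,
    so the larger one is attained.\<close>
  have factor: "av (a ^ n - 1) = max 1 (av a) ^ n" if "a \<in># ?R" for a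
  proof -
    have "av a \<noteq> 1" using that no_root[of a] nz by auto
    then consider "av a < 1" | "av a > 1" by linarith
    then show ?thesis
    proof cases
      case 1
      then have "av (a ^ n) < av (- 1)"
        using n av_nonneg[of a] by (simp add: av_power av_minus av_1 power_less_one_iff)
      from av_add_eq_max[OF this] show ?thesis using 1 by (simp add: av_minus av_1 max_def)
    next
      case 2
      then have "av (- 1) < av (a ^ n)"
        using n by (simp add: av_power av_minus av_1 one_less_power)
      from av_add_eq_max[OF this] show ?thesis using 2 by (simp add: av_power max_def)
    qed
  qed
  have "(\<Prod>a\<in>#?R. av (a ^ n - 1)) = (\<Prod>a\<in>#?R. max 1 (av a) ^ n)"
    using factor by (intro arg_cong[where f = prod_mset] image_mset_cong)
  also have "(\<Prod>a\<in>#A. max 1 (av a) ^ n) = (\<Prod>a\<in>#A. max 1 (av a)) ^ n" for A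
    by (induction A) (simp_all add: power_mult_distrib)
  finally show ?thesis
    by (simp add: pierce_lehmer_def mahler_def av_mult av_power av_prod_mset power_mult_distrib)
qed

text \<open>Each factor \<open>t - 1\<close> keeps the leading coefficient and adds the root 1,
  which contributes \<open>max 1 1\<close>. This allows passing from \<open>I\<close> to
  \<open>J\<close>.\<close>

lemma (in padic_complex) mahler_mult_unit_root:
  fixes f :: "int poly"
  assumes "f \<noteq> 0"
  shows "mahler av ([:- 1, 1:] ^ e * f) = mahler av f"
proof (induction e)
  case (Suc e)
  let ?g = "[:- 1, 1:] ^ e * f" and ?h = "map_poly of_int :: int poly \<Rightarrow> 'a poly"
  have "?g \<noteq> 0" using assms by simp
  then have nz: "?h ?g \<noteq> 0" by (metis of_int_poly_hom.hom_0_iff)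
  have "[:- 1, 1:] ^ Suc e * f = [:- 1, 1:] * ?g" by (simp only: power_Suc mult.assoc)
  moreover have "?h ([:- 1, 1:] * ?g) = [:- 1, 1:] * ?h ?g"
    by (simp only: of_int_poly_hom.hom_mult) (simp add: map_poly_pCons)
  moreover have "proots ([:- 1, 1:] * ?h ?g) = add_mset 1 (proots (?h ?g))"
    using nz by (subst proots_mult) auto
  moreover have "lead_coeff ([:- 1, 1:] * ?g) = lead_coeff ?g" by (simp only: lead_coeff_mult) simp
  ultimately have "mahler av ([:- 1, 1:] ^ Suc e * f) = mahler av ?g"
    by (simp only: mahler_def image_mset_add_mset prod_mset.add_mset av_1 max.idem mult_1)
  then show ?case using Suc by simp
qed simp

section \<open>Values of the Ihara polynomial at nonzero points\<close>

lemma comm_ring_hom_fls_of_poly: "comm_ring_hom fls_of_poly"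
  by unfold_locales
    (simp_all add: fps_of_poly_add fps_of_poly_mult fls_times_fps_to_fls)

lemma fls_of_poly_monom: "fls_of_poly (monom 1 k) = fls_X_intpow (int k)"
  by (intro fls_eqI) (auto simp: nat_eq_iff)

lemma setdet_smult:
  "setdet V (\<lambda>v w. c * M v w) = c ^ card V * setdet V M"
  unfolding setdet_def by (simp add: prod.distrib sum_distrib_left mult_ac)

lemma setdet_eq_ihara:
  assumes "distinct vs" "set vs = verts X"
  shows "ihara X \<alpha> vs = setdet (verts X) (\<lambda>v w.
      (if v = w then of_nat (card (out_arcs X v)) else 0)
      - (\<Sum>e | e \<in> out_arcs X v \<and> head X e = w. fls_X_intpow (\<alpha> e)))"
proof -
  have bij: "bij_betw ((!) vs) {0..<length vs} (verts X)"
    using bij_betw_nth[OF assms(1) _ assms(2)[symmetric]] by (simp add: atLeast0LessThan)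
  show ?thesis
    unfolding setdet_enumerate[OF bij] ihara_def
    by (intro arg_cong[where f = Determinant.det] eq_matI)
      (auto simp: valency_mat_def adjacency_mat_def nth_eq_iff_index_eq[OF assms(1)]
        out_arcs_def conj_assoc)
qed

text \<open>Multiplying all entries by a power of \<open>t\<close> turns the matrix into one over \<open>\<int>[t]\<close>, where
  evaluation is a ring homomorphism.\<close>

lemma poly_ihara:
  fixes z :: "'a :: field_char_0" and X :: "('v, 'e) pre_digraph"
  assumes "distinct vs" "set vs = verts X" and fin: "finite (arcs X)"
    and I: "fls_of_poly I = fls_X_intpow b * ihara X \<alpha> vs" and z: "z \<noteq> 0"
  shows "poly (map_poly of_int I) z = z powi b * setdet (verts X) (twisted_laplacian X \<alpha> z)"
proof -
  let ?V = "verts X"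
  \<comment> \<open>\<open>N\<close> bounds every voltage, so that the exponents
    \<open>N + \<alpha> e\<close> are nonnegative and \<open>nat\<close> loses nothing;
    \<open>m\<close> does the same for the possibly negative \<open>b\<close>.\<close>
  define N where "N = nat (\<Sum>e\<in>arcs X. \<bar>\<alpha> e\<bar>)"
  define m where "m = nat \<bar>b\<bar>"
  define P where "P v w = (if v = w then monom (int (card (out_arcs X v))) N else 0)
    - (\<Sum>e | e \<in> out_arcs X v \<and> head X e = w. monom 1 (nat (int N + \<alpha> e)))" for v w
  have N: "int N + \<alpha> e \<ge> 0" if "e \<in> arcs X" for e
  proof -
    have "\<bar>\<alpha> e\<bar> \<le> (\<Sum>e\<in>arcs X. \<bar>\<alpha> e\<bar>)" using that fin by (intro member_le_sum) auto
    then show ?thesis by (simp add: N_def)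
  qed
  interpret F: comm_ring_hom fls_of_poly by (rule comm_ring_hom_fls_of_poly)
  have monom_const: "monom (int k) l = of_nat k * monom 1 l" for k l
    by (simp add: of_nat_poly smult_monom)
  have "fls_of_poly (P v w) = fls_X_intpow (int N) *
      ((if v = w then of_nat (card (out_arcs X v)) else 0)
      - (\<Sum>e | e \<in> out_arcs X v \<and> head X e = w. fls_X_intpow (\<alpha> e)))" for v w
  proof -
    have "fls_of_poly (P v w) = (if v = w then of_nat (card (out_arcs X v)) * fls_X_intpow (int N) else 0)
      - (\<Sum>e | e \<in> out_arcs X v \<and> head X e = w. fls_X_intpow (int (nat (int N + \<alpha> e))))"
      unfolding P_def F.hom_minus F.hom_sum fls_of_poly_monom[symmetric]
      by (simp add: monom_const F.hom_mult F.hom_of_nat del: of_nat_mult)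
    also have "(\<Sum>e | e \<in> out_arcs X v \<and> head X e = w. fls_X_intpow (int (nat (int N + \<alpha> e)))) =
        (\<Sum>e | e \<in> out_arcs X v \<and> head X e = w. fls_X_intpow (int N) * fls_X_intpow (\<alpha> e) :: int fls)"
      by (intro sum.cong refl) (use N in \<open>auto simp: fls_X_intpow_times_fls_X_intpow\<close>)
    finally show ?thesis by (simp add: sum_distrib_left right_diff_distrib mult.commute)
  qed
  then have P: "fls_of_poly (setdet ?V P) = fls_X_intpow (int N) ^ card ?V * ihara X \<alpha> vs"
    by (simp only: setdet_hom[OF comm_ring_hom_fls_of_poly] setdet_smult setdet_eq_ihara[OF assms(1,2)])
  have mb: "fls_X_intpow (int (nat (int m + b))) = (fls_X_intpow (int m) * fls_X_intpow b :: int fls)"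
    by (simp add: fls_X_intpow_times_fls_X_intpow m_def)
  have "fls_of_poly (monom 1 m * monom 1 N ^ card ?V * I) =
      fls_of_poly (monom 1 (nat (int m + b)) * setdet ?V P)"
    by (simp only: F.hom_mult F.hom_power fls_of_poly_monom I P mb mult_ac)
  \<comment> \<open>The embedding of polynomials into Laurent series is injective, so the identity
    descends to integer polynomials, which can be evaluated at \<open>z\<close>.\<close>
  then have eq: "monom 1 m * monom 1 N ^ card ?V * I = monom 1 (nat (int m + b)) * setdet ?V P"
    by (simp add: fps_of_poly_eq_iff)
  let ?h = "\<lambda>q. poly (map_poly of_int q) z"
  have hom: "comm_ring_hom ?h"
    by unfold_locales (simp_all add: hom_distribs)
  interpret h: comm_ring_hom ?h by (rule hom)
  have monom: "?h (monom 1 k) = z ^ k" for k by (simp add: map_poly_monom poly_monom)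
  have "?h (P v w) = z ^ N * twisted_laplacian X \<alpha> z v w" for v w
  proof -
    have "?h (P v w) = (if v = w then of_nat (card (out_arcs X v)) * z ^ N else 0)
      - (\<Sum>e | e \<in> out_arcs X v \<and> head X e = w. z ^ nat (int N + \<alpha> e))"
      unfolding P_def h.hom_minus h.hom_sum monom
      by (simp add: map_poly_monom poly_monom)
    also have "(\<Sum>e | e \<in> out_arcs X v \<and> head X e = w. z ^ nat (int N + \<alpha> e)) =
        (\<Sum>e | e \<in> out_arcs X v \<and> head X e = w. z ^ N * z powi \<alpha> e)"
    proof (intro sum.cong refl)
      fix e assume "e \<in> {e. e \<in> out_arcs X v \<and> head X e = w}"
      then have "z ^ nat (int N + \<alpha> e) = z powi (int N + \<alpha> e)"
        using N[of e] by (simp add: power_int_def)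
      then show "z ^ nat (int N + \<alpha> e) = z ^ N * z powi \<alpha> e" using z by (simp add: power_int_add)
    qed
    finally show ?thesis
      by (simp add: twisted_laplacian_def sum_distrib_left right_diff_distrib mult.commute)
  qed
  then have "?h (setdet ?V P) = (z ^ N) ^ card ?V * setdet ?V (twisted_laplacian X \<alpha> z)"
    by (simp only: setdet_hom[OF hom] setdet_smult)
  moreover have "z ^ nat (int m + b) = z ^ m * z powi b"
  proof -
    have "z ^ nat (int m + b) = z powi (int m + b)" by (simp add: power_int_def m_def)
    then show ?thesis using z by (simp add: power_int_add)
  qed
  moreover have "z ^ m * (z ^ N) ^ card ?V * ?h I = z ^ nat (int m + b) * ?h (setdet ?V P)"
    using arg_cong[OF eq, of ?h] by (simp only: h.hom_mult h.hom_power monom)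
  ultimately have "(z ^ m * (z ^ N) ^ card ?V) * ?h I =
      (z ^ m * (z ^ N) ^ card ?V) * (z powi b * setdet ?V (twisted_laplacian X \<alpha> z))"
    by (simp add: mult_ac)
  then show ?thesis using z by simp
qed

theorem corollary3p15:
  fixes X :: "('v, 'e) pre_digraph" and bar :: "'e \<Rightarrow> 'e" and \<alpha> :: "'e \<Rightarrow> int"
    and vs :: "'v list" and b :: int and e :: nat and I J :: "int poly"
    and p n :: nat and av :: "'a :: field_char_0 \<Rightarrow> real"
  assumes graph: "bidirected_digraph X bar" "fin_digraph X" "strongly_connected X"
    and euler_char: "euler_char X \<noteq> 0"
    and voltage: "voltage_assignment X bar integer_group \<alpha>"
    and connected_cover: "strongly_connected (derived_graph X integer_group \<alpha>)"
    and order_verts: "distinct vs" "set vs = verts X"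
    and b: "b = - laurent_ord 0 (ihara X \<alpha> vs)"
    and I: "fls_of_poly I = fls_X_intpow b * ihara X \<alpha> vs"
    and e: "int e = laurent_ord 1 (ihara X \<alpha> vs)"
    and J: "I = [:- 1, 1:] ^ e * J"
    and p: "prime p"
    and C_p: "padic_complex p av"
    and no_root: "\<And>x :: 'a. av x = 1 \<Longrightarrow> poly (map_poly of_int J) x \<noteq> 0"
    and n: "n \<ge> 1"
  shows "av (of_nat (num_spanning_trees
                (derived_graph X (integer_mod_group n) (\<lambda>a. \<alpha> a mod int n))
                (derived_bar X bar (integer_mod_group n) (\<lambda>a. \<alpha> a mod int n))))
       = av (of_nat n) powi (int e - 1)
         * (av (of_nat (num_spanning_trees X bar)) / av (pierce_lehmer 1 J))
         * mahler av I ^ n"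
proof -
  interpret padic_complex p av by fact
  interpret fin_digraph X by fact
  have n0: "n > 0" using n by simp
  let ?Z = "{z :: 'a. z ^ n = 1}" and ?Z' = "{z :: 'a. z ^ n = 1 \<and> z \<noteq> 1}"
  let ?\<kappa>n = "num_spanning_trees (derived_graph X (integer_mod_group n) (\<lambda>a. \<alpha> a mod int n))
    (derived_bar X bar (integer_mod_group n) (\<lambda>a. \<alpha> a mod int n))"
  let ?J = "\<lambda>z :: 'a. av (poly (map_poly of_int J) z)"
  have J0: "J \<noteq> 0" using no_root[OF av_1] by auto
  \<comment> \<open>On roots of unity the monomial \<open>z powi b\<close> has absolute value 1, so
    the determinant and \<open>I\<close> agree up to \<open>av\<close>.\<close>
  have det: "av (setdet (verts X) (twisted_laplacian X \<alpha> z)) = av (1 - z) ^ e * ?J z"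
    if z: "z \<in> ?Z" for z
  proof -
    have "z \<noteq> 0" using z n0 by (auto simp: power_0_left)
    have "av z = 1" using z n0 by (intro av_root_of_unity) auto
    have "av (z powi b) = 1"
    proof (cases "b \<ge> 0")
      case True
      then show ?thesis using \<open>av z = 1\<close> by (simp add: power_int_def av_power)
    next
      case False
      then have "z powi b * z ^ nat (- b) = 1"
        using \<open>z \<noteq> 0\<close> by (simp add: power_int_def power_mult_distrib[symmetric])
      from arg_cong[OF this, of av] show ?thesis using \<open>av z = 1\<close> by (simp add: av_mult av_power av_1)
    qed
    then have "av (setdet (verts X) (twisted_laplacian X \<alpha> z)) = av (poly (map_poly of_int I) z)"
      by (simp add: poly_ihara[OF order_verts finite_arcs I \<open>z \<noteq> 0\<close>] av_mult)
    also have "poly (map_poly of_int I) z = (z - 1) ^ e * poly (map_poly of_int J) z"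
      unfolding J by (simp add: hom_distribs)
    finally show ?thesis by (simp add: av_mult av_power av_diff_commute)
  qed
  have "verts X \<noteq> {}" using graph(3) by (simp add: strongly_connected_def)
  from num_spanning_trees_cyclic_cover[OF graph(1,2) this voltage n0 card_roots_of_unity[OF n0]]
  have "av (of_nat n) * av (of_nat ?\<kappa>n) = av (of_nat (num_spanning_trees X bar)) *
      (\<Prod>z\<in>?Z'. av (setdet (verts X) (twisted_laplacian X \<alpha> z)))"
    by (simp only: of_nat_mult flip: av_mult av_prod)
  also have "(\<Prod>z\<in>?Z'. av (setdet (verts X) (twisted_laplacian X \<alpha> z))) =
      (\<Prod>z\<in>?Z'. av (1 - z) ^ e * ?J z)"
    by (intro prod.cong refl det) simp
  \<comment> \<open>The factors \<open>1 - z\<close> over the nontrivial roots of unity multiply to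
    \<open>n\<close>.\<close>
  also have "\<dots> = av (of_nat n) ^ e * (\<Prod>z\<in>?Z'. ?J z)"
    by (simp add: prod.distrib prod_power_distrib[symmetric] av_prod[symmetric]
        prod_nontrivial_roots_of_unity[OF n0])
  finally have eq: "av (of_nat n) * av (of_nat ?\<kappa>n) =
      av (of_nat (num_spanning_trees X bar)) * (av (of_nat n) ^ e * (\<Prod>z\<in>?Z'. ?J z))" .
  have J1: "av (pierce_lehmer 1 J) = ?J 1"
    using av_pierce_lehmer[OF J0, of 1] by simp
  have "?J 1 \<noteq> 0" using no_root[OF av_1] by (simp add: av_eq_0_iff)
  \<comment> \<open>The Mahler measure yields the product over all roots of unity. The tree count
    involves only the nontrivial ones, and the factor at \<open>z = 1\<close> is the absolute value
    of \<open>pierce_lehmer 1 J\<close>, hence the quotient in the formula.\<close>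
  have "mahler av I ^ n = av (pierce_lehmer n J)"
    unfolding J mahler_mult_unit_root[OF J0] by (rule av_pierce_lehmer_eq_mahler[OF J0 no_root n0, symmetric])
  also have "\<dots> = (\<Prod>z\<in>?Z. ?J z)" by (rule av_pierce_lehmer[OF J0 n0])
  also have "?Z = insert 1 ?Z'" by auto
  also have "(\<Prod>z\<in>insert 1 ?Z'. ?J z) = ?J 1 * (\<Prod>z\<in>?Z'. ?J z)"
    using finite_roots_of_unity[OF n0] by (subst prod.insert) auto
  finally have mahler: "mahler av I ^ n = ?J 1 * (\<Prod>z\<in>?Z'. ?J z)" .
  have nz: "av (of_nat n) \<noteq> 0" using n0 by (simp add: av_eq_0_iff)
  then have powi: "av (of_nat n) powi (int e - 1) = av (of_nat n) ^ e / av (of_nat n)"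
    by (simp add: power_int_diff)
  have "av (of_nat ?\<kappa>n) = av (of_nat n) ^ e / av (of_nat n) *
      (av (of_nat (num_spanning_trees X bar)) * (\<Prod>z\<in>?Z'. ?J z))"
    using eq nz by (simp add: field_simps)
  then show ?thesis
    unfolding mahler J1 powi using \<open>?J 1 \<noteq> 0\<close> by simp
qed

end
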